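(* As formal power series, \[ A_{\{3,4\}}(x,y) = \frac{1-x^2-x^3y-x^4+x^6}{(1- x^3y^3 - x^4y^4)(1-x^2-x^3y-x^4+x^6) - 2x^7y + 2x^9 y}, \] and for any integer $c \geq 1$, $A_{\{3c,4c\}}(x,y) = A_{\{3,4\}}(x^c,y^c)$.
   Context: A composition of $n$ is an ordered list of positive integers (parts) with sum $n$; the empty list is the unique composition of $0$. A meander on $n$ nodes is a pair $\frac{\lambda}{\mu}$ of compositions of $n$, viewed as a planar (multi)graph on vertices $1,\dots,n$: for each part $a$ of $\lambda$, occupying the consecutive vertices $p+1,\dots,p+a$ (where $p$ is the sum of the preceding parts), there is an upper edge joining $p+i$ and $p+a+1-i$ for each $1\le i\le \lfloor a/2\rfloor$; lower edges are defined in the same way from $\mu$. If the same two vertices are joined by both an upper and a lower edge, both edges are kept and form a cycle. Every connected component is a cycle or a path (an isolated vertex counts as a path). The index is $\operatorname{ind}(\frac{\lambda}{\mu}) = 2c+p$, where here $c$ is the number of cycles and $p$ is the number of paths (this equals the index of the associated seaweed subalgebra of $\mathfrak{gl}_n$). For a set $J$ of positive integers, $a^J_{n,k}$ is the number of meanders $\frac{\lambda}{\mu}$ on $n$ nodes of index $k$ such that all parts of $\lambda$ and $\mu$ lie in $J$, and $A_J(x,y)=\sum_{n,k\ge 0} a^J_{n,k}x^ny^k$ (the empty meander gives $a^J_{0,0}=1$). *)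

theory Defs
  imports "HOL-Computational_Algebra.Formal_Power_Series"
begin

definition composition :: "nat \<Rightarrow> nat list \<Rightarrow> bool" where
  "composition n xs \<longleftrightarrow> (\<forall>a\<in>set xs. 0 < a) \<and> sum_list xs = n"

definition part_edges :: "nat list \<Rightarrow> (nat \<times> nat) set" where
  "part_edges xs = {(p + i, p + a + 1 - i) | p a i.
     \<exists>j<length xs. p = sum_list (take j xs) \<and> a = xs ! j \<and> 1 \<le> i \<and> i \<le> a div 2}"

text \<open>Edges carry their side, so an upper and a lower edge with the same ends stay distinct.\<close>

datatype side = Upper | Lower

type_synonym edge = "side \<times> nat \<times> nat"

fun ends :: "edge \<Rightarrow> nat set" where
  "ends (s, u, v) = {u, v}"

definition meander_edges :: "nat list \<Rightarrow> nat list \<Rightarrow> edge set" where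
  "meander_edges xs ys = {Upper} \<times> part_edges xs \<union> {Lower} \<times> part_edges ys"

definition components :: "nat set \<Rightarrow> edge set \<Rightarrow> nat set set" where
  "components V E =
     V // {(u, v). u \<in> V \<and> v \<in> V \<and> (u, v) \<in> {(x, y). \<exists>e\<in>E. ends e = {x, y}}\<^sup>*}"

definition edges_at :: "edge set \<Rightarrow> nat set \<Rightarrow> edge set" where
  "edges_at E C = {e \<in> E. ends e \<inter> C \<noteq> {}}"

text \<open>
  A component is a cycle (a path) if its vertices and its edges can be enumerated, each exactly
  once, along a closed (an open) trail. The shortest cycle consists of two parallel edges; the
  shortest path is an isolated vertex, with no edges.
\<close>

definition is_cycle :: "edge set \<Rightarrow> nat set \<Rightarrow> bool" where
  "is_cycle E C \<longleftrightarrow> (\<exists>vs es. distinct vs \<and> set vs = C \<and> distinct es \<and> set es = edges_at E C \<and>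
     2 \<le> length vs \<and> length es = length vs \<and>
     (\<forall>i<length es. ends (es ! i) = {vs ! i, vs ! (Suc i mod length vs)}))"

definition is_path :: "edge set \<Rightarrow> nat set \<Rightarrow> bool" where
  "is_path E C \<longleftrightarrow> (\<exists>vs es. distinct vs \<and> set vs = C \<and> distinct es \<and> set es = edges_at E C \<and>
     length vs = Suc (length es) \<and>
     (\<forall>i<length es. ends (es ! i) = {vs ! i, vs ! Suc i}))"

definition meander_index :: "nat \<Rightarrow> nat list \<Rightarrow> nat list \<Rightarrow> nat" where
  "meander_index n xs ys =
     (let E = meander_edges xs ys; K = components {1..n} E
      in 2 * card {C \<in> K. is_cycle E C} + card {C \<in> K. is_path E C})"

definition meander_count :: "nat set \<Rightarrow> nat \<Rightarrow> nat \<Rightarrow> nat" where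
  "meander_count J n k = card {(xs, ys). composition n xs \<and> composition n ys \<and>
     set xs \<subseteq> J \<and> set ys \<subseteq> J \<and> meander_index n xs ys = k}"

text \<open>
  Bivariate power series in \<open>x, y\<close> are power series in \<open>x\<close> over the ring of power series in \<open>y\<close>.
  Division on \<^typ>\<open>rat fps fps\<close> is the library's division of power series; a denominator with
  constant coefficient 1 is invertible, as the lemma below confirms.
\<close>

type_synonym bifps = "rat fps fps"

abbreviation X :: bifps where "X \<equiv> fps_X"

abbreviation Y :: bifps where "Y \<equiv> fps_const fps_X"

definition meander_gf :: "nat set \<Rightarrow> bifps" where
  "meander_gf J = Abs_fps (\<lambda>n. Abs_fps (\<lambda>k. of_nat (meander_count J n k)))"

text \<open>\<open>subst_powers c F\<close> is $F(x^c, y^c)$; the substitution is meaningful for \<open>c \<ge> 1\<close>.\<close>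

definition subst_powers :: "nat \<Rightarrow> bifps \<Rightarrow> bifps" where
  "subst_powers c F = Abs_fps (\<lambda>n. fps_nth F n oo fps_X ^ c) oo fps_X ^ c"

lemma bifps_divide_mult:
  fixes F G :: bifps
  assumes "fps_nth G 0 = 1"
  shows "F / G * G = F"
proof -
  have "inverse (fps_nth G 0) = 1"
    using assms by (simp add: fps_inverse_one')
  hence "G * inverse G = 1"
    using assms by (simp add: fps_inverse_def fps_right_inverse)
  hence "inverse G * G = 1"
    by (simp add: mult.commute)
  moreover have "F / G = F * inverse G"
    using assms by (simp add: fps_divide_def)
  ultimately show ?thesis by (simp add: mult.assoc)
qed

end

theory Submission
  imports Defs
begin

text \<open>
  Reflecting every part of the upper (lower) composition gives an involution \<open>U\<close> (\<open>L\<close>) of the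
  vertices whose fixed points are the midpoints of odd parts. A cycle of the meander consists of two
  orbits of \<open>U \<circ> L\<close> and a path of one, so the index is the number of cycles of this permutation.
  Multiplying all parts by \<open>c\<close> replaces the permutation by \<open>c\<close> disjoint copies of itself, whence the
  second claim.

  For the first claim, remove parts from the left. By Panyushev's reduction, the only information
  that the removed parts leave behind is a prefix \<open>[]\<close>, \<open>[1]\<close>, \<open>[1, 1]\<close> or \<open>[2, 1]\<close> on the side
  that reaches further, and this prefix is determined by the overhang, which lies between 0 and 3.
  The resulting four generating functions satisfy a linear system, with \<open>F d\<close> for overhang \<open>d\<close>.
\<close>

unbundle fps_syntax

subsection \<open>Counting orbits\<close>

text \<open>The index is defined through enumerations of vertices and edges, which change throughout
  when a vertex is bypassed. A count of orbits is not affected by a bypass, so the passage to a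
  permutation is made once and all reductions are carried out on orbit counts. A cycle gives two
  orbits because each reflection switches between even and odd positions along it; at the end of a
  path one reflection fixes the end, and this joins the two parities. The prefixes are those reached
  from \<open>[1]\<close>, which 3 against 4 leaves behind, by setting further parts 3 or 4 against
  the prefix. For nonzero overhang, a factor \<open>y\<close> appears exactly when two equal parts 1
  meet and cancel. The two orders, 3 over 4 and 4 over 3, contribute equally, whence the coefficient
  2 in the denominator.\<close>

definition conn :: "'a set \<Rightarrow> ('a \<Rightarrow> 'a) \<Rightarrow> 'a \<Rightarrow> 'a \<Rightarrow> bool" where
  "conn A f = equivclp (\<lambda>x y. x \<in> A \<and> y = f x)"

definition orbit_rel :: "'a set \<Rightarrow> ('a \<Rightarrow> 'a) \<Rightarrow> ('a \<times> 'a) set" where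
  "orbit_rel A f = {(u, v). u \<in> A \<and> v \<in> A \<and> conn A f u v}"

definition ncyc :: "'a set \<Rightarrow> ('a \<Rightarrow> 'a) \<Rightarrow> nat" where
  "ncyc A f = card (A // orbit_rel A f)"

lemma conn_refl [simp]: "conn A f x x"
  by (simp add: conn_def)

lemma conn_sym: "conn A f x y \<Longrightarrow> conn A f y x"
  by (simp add: conn_def equivclp_sym)

lemma conn_trans [trans]: "conn A f x y \<Longrightarrow> conn A f y z \<Longrightarrow> conn A f x z"
  unfolding conn_def by (rule equivclp_trans)

lemma conn_step: "x \<in> A \<Longrightarrow> conn A f x (f x)"
  unfolding conn_def by (rule r_into_equivclp) simp

lemma conn_map:
  assumes "conn A f x y" and "\<And>x. x \<in> A \<Longrightarrow> conn B g (r x) (r (f x))"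
  shows "conn B g (r x) (r y)"
  using assms(1) unfolding conn_def
proof (induction rule: equivclp_induct)
  case base
  then show ?case by simp
next
  case (step y z)
  then have "conn B g (r y) (r z)"
    using assms(2) conn_sym by metis
  with step.IH show ?case
    by (metis conn_def conn_trans)
qed

lemma conn_invariant:
  assumes "conn A f x y" and "\<And>x. x \<in> A \<Longrightarrow> P (f x) = P x"
  shows "P x = P y"
  using assms(1) unfolding conn_def
  by (induction rule: equivclp_induct) (use assms(2) in auto)

lemma equiv_orbit_rel: "equiv A (orbit_rel A f)"
  by (rule equivI)
    (auto simp: orbit_rel_def refl_on_def sym_def trans_def intro: conn_sym conn_trans)

text \<open>A map that preserves and reflects the relations descends to an injection of classes.
  Saturating the image of a class under \<open>R\<close> gives this map without a choice of
  representatives.\<close>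

lemma card_quotient_le:
  assumes A: "equiv A R" and B: "equiv B S" and fin: "finite A"
    and r: "\<And>x y. (x, y) \<in> S \<Longrightarrow> (i x, i y) \<in> R"
    and inj: "\<And>x y. x \<in> B \<Longrightarrow> y \<in> B \<Longrightarrow> (i x, i y) \<in> R \<Longrightarrow> (x, y) \<in> S"
  shows "card (B // S) \<le> card (A // R)"
proof -
  have key: "R `` (i ` (S `` {x})) = R `` {i x}" if "x \<in> B" for x
  proof -
    have "(x, x) \<in> S"
      using B that by (meson equivE refl_onD)
    moreover have "R `` {i y} = R `` {i x}" if "(x, y) \<in> S" for y
      using r[OF that] equiv_class_eq[OF A] by metis
    ultimately show ?thesis
      by blast
  qed
  have "inj_on (\<lambda>C. R `` (i ` C)) (B // S)"
  proof (rule inj_onI)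
    fix C D
    assume CD: "C \<in> B // S" "D \<in> B // S" "R `` (i ` C) = R `` (i ` D)"
    obtain x y where x: "x \<in> B" "C = S `` {x}" and y: "y \<in> B" "D = S `` {y}"
      using CD by (auto elim!: quotientE)
    have "(i y, i y) \<in> R"
      using r B y by (meson equivE refl_onD)
    then have "(i x, i y) \<in> R"
      using CD(3) key x y by auto
    then show "C = D"
      using inj x y equiv_class_eq[OF B] by metis
  qed
  moreover have "(\<lambda>C. R `` (i ` C)) ` (B // S) \<subseteq> A // R"
  proof clarify
    fix C assume "C \<in> B // S"
    then obtain x where x: "x \<in> B" "C = S `` {x}" by (auto elim!: quotientE)
    then have "(i x, i x) \<in> R"
      using r B by (meson equivE refl_onD)
    then have "i x \<in> A"
      using A by (meson equiv_class_eq_iff)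
    then show "R `` (i ` C) \<in> A // R"
      using key x by (auto intro: quotientI)
  qed
  ultimately show ?thesis
    using fin A by (meson card_inj_on_le equiv_type finite_quotient)
qed

text \<open>\<open>i\<close> sends orbits to orbits by \<open>i_step\<close>, and different orbits
  to different ones because \<open>r\<close> undoes it up to movement along an orbit. Exchanging the
  roles of \<open>r\<close> and \<open>i\<close> later gives the opposite inequality.\<close>

lemma ncyc_le:
  assumes fin: "finite A"
    and i: "\<And>y. y \<in> B \<Longrightarrow> i y \<in> A"
    and r_step: "\<And>x. x \<in> A \<Longrightarrow> conn B g (r x) (r (f x))"
    and i_step: "\<And>y. y \<in> B \<Longrightarrow> conn A f (i y) (i (g y))"
    and ri: "\<And>y. y \<in> B \<Longrightarrow> conn B g (r (i y)) y"
  shows "ncyc B g \<le> ncyc A f"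
  unfolding ncyc_def
proof (rule card_quotient_le[OF equiv_orbit_rel equiv_orbit_rel fin])
  fix x y
  show "(x, y) \<in> orbit_rel B g \<Longrightarrow> (i x, i y) \<in> orbit_rel A f"
    using i by (auto simp: orbit_rel_def intro: conn_map i_step)
next
  fix x y
  assume xy: "x \<in> B" "y \<in> B" "(i x, i y) \<in> orbit_rel A f"
  have "conn B g (r (i x)) (r (i y))"
    using xy by (auto simp: orbit_rel_def intro: conn_map r_step)
  then show "(x, y) \<in> orbit_rel B g"
    using xy conn_trans[OF conn_trans[OF conn_sym[OF ri] _] ri] by (simp add: orbit_rel_def)
qed

text \<open>The maps \<open>r\<close> and \<open>i\<close> need only be inverse to each other up to moving along orbits, so
  points may be deleted from or inserted into the cycles.\<close>

lemma ncyc_eq: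
  assumes "finite A" "finite B"
    and "\<And>x. x \<in> A \<Longrightarrow> r x \<in> B"
    and "\<And>y. y \<in> B \<Longrightarrow> i y \<in> A"
    and "\<And>x. x \<in> A \<Longrightarrow> conn B g (r x) (r (f x))"
    and "\<And>y. y \<in> B \<Longrightarrow> conn A f (i y) (i (g y))"
    and "\<And>x. x \<in> A \<Longrightarrow> conn A f (i (r x)) x"
    and "\<And>y. y \<in> B \<Longrightarrow> conn B g (r (i y)) y"
  shows "ncyc A f = ncyc B g"
  by (rule antisym) (rule ncyc_le[where i = r and r = i] ncyc_le[where i = i and r = r]; fact assms)+

lemma ncyc_cong:
  assumes "\<And>x. x \<in> A \<Longrightarrow> f x = g x"
  shows "ncyc A f = ncyc A g"
proof -
  have "(\<lambda>x y. x \<in> A \<and> y = f x) = (\<lambda>x y. x \<in> A \<and> y = g x)"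
    using assms by (auto simp: fun_eq_iff)
  then show ?thesis
    by (simp add: ncyc_def orbit_rel_def conn_def)
qed

lemma ncyc_id:
  assumes "\<And>x. x \<in> A \<Longrightarrow> f x = x"
  shows "ncyc A f = card A"
proof -
  have "x = y" if "conn A f x y" for x y
    using conn_invariant[OF that, of "\<lambda>z. z = x"] assms by auto
  then have "orbit_rel A f = Id_on A"
    by (auto simp: orbit_rel_def)
  then have "A // orbit_rel A f = (\<lambda>x. {x}) ` A"
    by (auto simp: quotient_def)
  then show ?thesis
    by (simp add: ncyc_def card_image)
qed

lemma ncyc_Un:
  assumes fin: "finite A" "finite B" and disj: "A \<inter> B = {}"
    and A: "\<And>x. x \<in> A \<Longrightarrow> f x \<in> A" and B: "\<And>x. x \<in> B \<Longrightarrow> f x \<in> B"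
  shows "ncyc (A \<union> B) f = ncyc A f + ncyc B f"
proof -
  \<comment> \<open>Invariance of both sets makes membership constant along orbits, also in backward
    steps: a preimage of a point of \<open>A\<close> cannot lie in \<open>B\<close>.\<close>
  have mem: "x \<in> A \<longleftrightarrow> y \<in> A" "x \<in> B \<longleftrightarrow> y \<in> B" if "conn (A \<union> B) f x y" for x y
    using conn_invariant[OF that, of "\<lambda>z. z \<in> A"] conn_invariant[OF that, of "\<lambda>z. z \<in> B"]
      A B disj by blast+
  have connA: "conn (A \<union> B) f x y \<longleftrightarrow> conn A f x y" if "x \<in> A" for x y
  proof
    assume "conn (A \<union> B) f x y"
    then have "y \<in> A \<and> conn A f x y"
      using \<open>x \<in> A\<close> unfolding conn_def
    proof (induction rule: equivclp_induct)
      case (step y z)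
      then show ?case
        using A B disj conn_step[of y A f] conn_step[of z A f] unfolding conn_def[symmetric]
        by (metis Un_iff disjoint_iff conn_sym conn_trans)
    qed simp
    then show "conn A f x y" ..
  next
    assume "conn A f x y"
    then show "conn (A \<union> B) f x y"
      using conn_map[where r = "\<lambda>x. x"] conn_step by (metis UnI1)
  qed
  have connB: "conn (A \<union> B) f x y \<longleftrightarrow> conn B f x y" if "x \<in> B" for x y
  proof
    assume "conn (A \<union> B) f x y"
    then have "y \<in> B \<and> conn B f x y"
      using \<open>x \<in> B\<close> unfolding conn_def
    proof (induction rule: equivclp_induct)
      case (step y z)
      then show ?case
        using A B disj conn_step[of y B f] conn_step[of z B f] unfolding conn_def[symmetric]
        by (metis Un_iff disjoint_iff conn_sym conn_trans)
    qed simp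
    then show "conn B f x y" ..
  next
    assume "conn B f x y"
    then show "conn (A \<union> B) f x y"
      using conn_map[where r = "\<lambda>x. x"] conn_step by (metis UnI2)
  qed
  have clA: "orbit_rel (A \<union> B) f `` {x} = orbit_rel A f `` {x}" if "x \<in> A" for x
    using that connA[OF that] mem(1)[of x] unfolding orbit_rel_def by blast
  have clB: "orbit_rel (A \<union> B) f `` {x} = orbit_rel B f `` {x}" if "x \<in> B" for x
    using that connB[OF that] mem(2)[of x] unfolding orbit_rel_def by blast
  have "(A \<union> B) // orbit_rel (A \<union> B) f = A // orbit_rel A f \<union> B // orbit_rel B f"
    unfolding quotient_def using clA clB by auto
  moreover have "A // orbit_rel A f \<inter> B // orbit_rel B f = {}"
  proof -
    have "C \<subseteq> A \<and> C \<noteq> {}" if "C \<in> A // orbit_rel A f" for C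
      using that in_quotient_imp_non_empty[OF equiv_orbit_rel] in_quotient_imp_subset[OF equiv_orbit_rel]
      by blast
    moreover have "C \<subseteq> B" if "C \<in> B // orbit_rel B f" for C
      using that in_quotient_imp_subset[OF equiv_orbit_rel] by blast
    ultimately show ?thesis
      using disj by blast
  qed
  moreover have "finite (A // orbit_rel A f)" "finite (B // orbit_rel B f)"
    using fin by (auto intro!: finite_quotient simp: orbit_rel_def)
  ultimately show ?thesis
    by (simp add: ncyc_def card_Un_disjoint)
qed

lemma ncyc_UN:
  assumes "finite I" "\<And>i. i \<in> I \<Longrightarrow> finite (A i)"
    and "\<And>i j. i \<in> I \<Longrightarrow> j \<in> I \<Longrightarrow> i \<noteq> j \<Longrightarrow> A i \<inter> A j = {}"
    and "\<And>i x. i \<in> I \<Longrightarrow> x \<in> A i \<Longrightarrow> f x \<in> A i"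
  shows "ncyc (\<Union>i\<in>I. A i) f = (\<Sum>i\<in>I. ncyc (A i) f)"
  using assms
proof (induction I rule: finite_induct)
  case empty
  then show ?case by (simp add: ncyc_def quotient_def)
next
  case (insert i I)
  have "ncyc (A i \<union> (\<Union>i\<in>I. A i)) f = ncyc (A i) f + ncyc (\<Union>i\<in>I. A i) f"
  proof (rule ncyc_Un)
    show "A i \<inter> \<Union> (A ` I) = {}"
      using insert.hyps insert.prems(2) by blast
    show "\<And>x. x \<in> \<Union> (A ` I) \<Longrightarrow> f x \<in> \<Union> (A ` I)"
      using insert.prems(3) by blast
  qed (use insert in auto)
  then show ?case
    using insert by simp
qed

subsection \<open>Reflections of the parts\<close>

text \<open>Vertices are numbered from 1, and a nonempty list sends 0 to the meaningless value
  \<open>a + 1\<close>; hence the hypotheses \<open>1 \<le> v\<close> below. Vertices beyond the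
  last part stay fixed.\<close>

fun refl_parts :: "nat list \<Rightarrow> nat \<Rightarrow> nat" where
  "refl_parts [] v = v"
| "refl_parts (a # xs) v = (if v \<le> a then a + 1 - v else a + refl_parts xs (v - a))"

definition cyc_index :: "nat list \<Rightarrow> nat list \<Rightarrow> nat" where
  "cyc_index xs ys = ncyc {1..sum_list xs} (refl_parts xs \<circ> refl_parts ys)"

lemma refl_parts_le: "v \<le> a \<Longrightarrow> refl_parts (a # xs) v = a + 1 - v"
  by simp

lemma refl_parts_add: "1 \<le> v \<Longrightarrow> refl_parts (a # xs) (a + v) = a + refl_parts xs v"
  by simp

lemma refl_parts_rev: "1 \<le> v \<Longrightarrow> v \<le> a \<Longrightarrow> refl_parts (a # xs) (a + 1 - v) = v"
  using refl_parts_le[of "a + 1 - v" a xs] by linarith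

lemma refl_parts_gt: "1 \<le> v \<Longrightarrow> 1 \<le> refl_parts xs v"
proof (induction xs arbitrary: v)
  case (Cons a xs)
  then show ?case
    using Cons.IH[of "v - a"] by (cases "v \<le> a") (simp_all add: Suc_le_eq)
qed simp

lemma refl_parts_bound: "v \<le> sum_list xs \<Longrightarrow> 1 \<le> v \<Longrightarrow> refl_parts xs v \<le> sum_list xs"
proof (induction xs arbitrary: v)
  case (Cons a xs)
  then show ?case
    using Cons.IH[of "v - a"] by (cases "v \<le> a") simp_all
qed simp

lemma refl_parts_mem:
  "1 \<le> v \<Longrightarrow> v \<le> sum_list xs \<Longrightarrow> 1 \<le> refl_parts xs v \<and> refl_parts xs v \<le> sum_list xs"
  using refl_parts_gt refl_parts_bound by blast

lemma refl_parts_invol: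
  "1 \<le> v \<Longrightarrow> v \<le> sum_list xs \<Longrightarrow> refl_parts xs (refl_parts xs v) = v"
proof (induction xs arbitrary: v)
  case (Cons a xs)
  show ?case
  proof (cases "v \<le> a")
    case True
    then have "a + 1 - v \<le> a"
      using Cons.prems by linarith
    with True show ?thesis
      by simp
  next
    case False
    define w where "w = v - a"
    have w: "v = a + w" "1 \<le> w" "w \<le> sum_list xs"
      using False Cons.prems by (auto simp: w_def)
    then show ?thesis
      using Cons.IH[OF w(2,3)] refl_parts_gt[OF w(2), of xs] by (simp only: refl_parts_add)
  qed
qed simp

text \<open>Conjugation by the reflection of \<open>ys\<close> turns
  \<open>refl_parts xs \<circ> refl_parts ys\<close> into the composition in the opposite
  order.\<close>

lemma cyc_index_sym:
  assumes "sum_list xs = sum_list ys"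
  shows "cyc_index xs ys = cyc_index ys xs"
  unfolding cyc_index_def
proof (rule ncyc_eq[where r = "refl_parts ys" and i = "refl_parts ys"])
  fix x assume x: "x \<in> {1..sum_list xs}"
  show "conn {1..sum_list ys} (refl_parts ys \<circ> refl_parts xs) (refl_parts ys x)
      (refl_parts ys ((refl_parts xs \<circ> refl_parts ys) x))"
    using conn_step[of "refl_parts ys x" "{1..sum_list ys}" "refl_parts ys \<circ> refl_parts xs"]
      refl_parts_mem[of x ys] x assms by simp
next
  fix x assume x: "x \<in> {1..sum_list ys}"
  show "conn {1..sum_list xs} (refl_parts xs \<circ> refl_parts ys) (refl_parts ys x)
      (refl_parts ys ((refl_parts ys \<circ> refl_parts xs) x))"
    using conn_step[of "refl_parts ys x" "{1..sum_list xs}" "refl_parts xs \<circ> refl_parts ys"]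
      refl_parts_mem[of x ys] refl_parts_mem[of x xs] x assms by (simp add: refl_parts_invol)
qed (use assms refl_parts_mem refl_parts_invol in \<open>auto simp: Suc_le_eq\<close>)

text \<open>Parts 0 arise from the reductions below when \<open>b = 2 * a\<close>, where both
  \<open>b - 2 * a\<close> and \<open>2 * a - b\<close> vanish.\<close>

lemma cyc_index_Cons_0 [simp]:
  assumes "sum_list xs = sum_list ys"
  shows "cyc_index (0 # xs) ys = cyc_index xs ys" "cyc_index xs (0 # ys) = cyc_index xs ys"
proof -
  have "refl_parts (0 # zs) v = refl_parts zs v" if "1 \<le> v" for v zs
    using that by simp
  then show "cyc_index (0 # xs) ys = cyc_index xs ys" "cyc_index xs (0 # ys) = cyc_index xs ys"
    unfolding cyc_index_def using refl_parts_mem[of _ ys] assms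
    by (auto intro!: ncyc_cong simp del: refl_parts.simps)
qed

text \<open>The two reflections agree on the first \<open>a\<close> vertices, which are therefore
  fixed points of the composition; the remaining vertices carry a translated copy of the shorter
  pair.\<close>

lemma cyc_index_Cons_same:
  assumes "sum_list xs = sum_list ys"
  shows "cyc_index (a # xs) (a # ys) = a + cyc_index xs ys"
proof -
  let ?f = "refl_parts (a # xs) \<circ> refl_parts (a # ys)" and ?n = "sum_list xs"
  have "ncyc ({1..a} \<union> {a+1..a+?n}) ?f = ncyc {1..a} ?f + ncyc {a+1..a+?n} ?f"
  proof (rule ncyc_Un)
    fix x assume x: "x \<in> {a+1..a+?n}"
    then have "refl_parts ys (x - a) \<in> {1..?n}"
      using refl_parts_mem[of "x - a" ys] assms by auto
    then show "?f x \<in> {a+1..a+?n}"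
      using refl_parts_mem[of "refl_parts ys (x - a)" xs] x by auto
  qed auto
  moreover have "{1..a} \<union> {a+1..a+?n} = {1..a+?n}"
    by auto
  moreover have "ncyc {1..a} ?f = a"
    by (subst ncyc_id) auto
  moreover have "ncyc {a+1..a+?n} ?f = ncyc {1..?n} (refl_parts xs \<circ> refl_parts ys)"
  proof (rule ncyc_eq[where r = "\<lambda>v. v - a" and i = "\<lambda>v. v + a"])
    fix x assume x: "x \<in> {a+1..a+?n}"
    then have xa: "x - a \<in> {1..?n}"
      by auto
    then have "1 \<le> refl_parts ys (x - a)"
      using refl_parts_mem[of "x - a" ys] assms by simp
    then have "?f x - a = (refl_parts xs \<circ> refl_parts ys) (x - a)"
      using x by simp
    then show "conn {1..?n} (refl_parts xs \<circ> refl_parts ys) (x - a) (?f x - a)"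
      using conn_step[OF xa] by metis
  next
    fix x assume x: "x \<in> {1..?n}"
    then have xa: "x + a \<in> {a+1..a+?n}"
      by auto
    have "1 \<le> refl_parts ys x"
      using refl_parts_mem[of x ys] x assms by simp
    then have "?f (x + a) = (refl_parts xs \<circ> refl_parts ys) x + a"
      using x by simp
    then show "conn {a+1..a+?n} ?f (x + a) ((refl_parts xs \<circ> refl_parts ys) x + a)"
      using conn_step[OF xa] by metis
  qed auto
  ultimately show ?thesis
    by (simp add: cyc_index_def)
qed

text \<open>This and the next lemma are Panyushev's reduction of seaweed algebras: on the last \<open>a\<close>
  vertices of the part \<open>b\<close> the permutation is translation by \<open>a - b\<close>, so the first
  \<open>min a (b - a)\<close> vertices can be bypassed.\<close>

lemma cyc_index_reduce_small:
  assumes ab: "2 * a \<le> b" and sums: "a + sum_list xs = b + sum_list ys"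
  shows "cyc_index (a # xs) (b # ys) = cyc_index xs ((b - 2 * a) # a # ys)"
proof -
  define m where "m = b - 2 * a"
  have b: "b = m + a + a" and s: "sum_list xs = m + a + sum_list ys"
    using ab sums by (auto simp: m_def)
  let ?n = "sum_list xs"
  let ?A = "{1..a + ?n}"
  let ?B = "{1..?n}"
  \<comment> \<open>The vertices fall into blocks of lengths \<open>a\<close>, \<open>m\<close>,
    \<open>a\<close> and a rest, and the first block is deleted. Its vertex \<open>v\<close> is the
    image of \<open>a + m + v\<close> in the third block; \<open>?r\<close> moves to that vertex and
    then subtracts \<open>a\<close>.\<close>
  let ?r = "\<lambda>v. if v \<le> a then m + v else v - a" and ?i = "\<lambda>v. a + v"
  define f g where "f = refl_parts (a # xs) \<circ> refl_parts (b # ys)"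
    and "g = refl_parts xs \<circ> refl_parts (m # a # ys)"
  have ge: "1 \<le> refl_parts zs v" "\<not> refl_parts zs v \<le> 0" if "1 \<le> v" for v zs
    using refl_parts_gt[OF that, of zs] by auto
  have f_left: "f x = a + refl_parts xs (m + (a + 1 - x))"
    and g_left: "g (m + x) = refl_parts xs (m + (a + 1 - x))" if "1 \<le> x" "x \<le> a" for x
  proof -
    have "refl_parts (b # ys) x = a + (m + (a + 1 - x))"
      using that b by (simp add: refl_parts_le)
    then show "f x = a + refl_parts xs (m + (a + 1 - x))"
      using that refl_parts_add[of "m + (a + 1 - x)" a xs] by (simp only: f_def g_def o_apply)
    have "refl_parts (m # a # ys) (m + x) = m + (a + 1 - x)"
      using that by (simp del: refl_parts.simps add: f_def g_def refl_parts_add refl_parts_le)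
    then show "g (m + x) = refl_parts xs (m + (a + 1 - x))"
      by (simp add: g_def)
  qed
  have f_mid: "f (a + t) = a + refl_parts xs (m + 1 - t)"
    and g_mid: "g t = refl_parts xs (m + 1 - t)" if "1 \<le> t" "t \<le> m" for t
  proof -
    have "refl_parts (b # ys) (a + t) = a + (m + 1 - t)"
      using that b by (simp add: refl_parts_le)
    then show "f (a + t) = a + refl_parts xs (m + 1 - t)"
      using that refl_parts_add[of "m + 1 - t" a xs] by (simp only: f_def g_def o_apply)
    show "g t = refl_parts xs (m + 1 - t)"
      using that by (simp del: refl_parts.simps add: f_def g_def refl_parts_le)
  qed
  have f_right: "f (a + (m + t)) = t" if "1 \<le> t" "t \<le> a" for t
  proof -
    have "refl_parts (b # ys) (a + (m + t)) = a + 1 - t"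
      using that b by (simp add: refl_parts_le)
    then show ?thesis
      using that refl_parts_rev[of t a xs] by (simp only: f_def g_def o_apply)
  qed
  have f_out: "f (a + (m + (a + t))) = a + refl_parts xs (m + (a + refl_parts ys t))"
    and g_out: "g (m + (a + t)) = refl_parts xs (m + (a + refl_parts ys t))" if "1 \<le> t" for t
  proof -
    have "a + (m + (a + t)) = b + t"
      using b by simp
    then have "refl_parts (b # ys) (a + (m + (a + t))) = b + refl_parts ys t"
      using that by (simp only: refl_parts_add)
    also have "\<dots> = a + (m + (a + refl_parts ys t))"
      using b by simp
    finally show "f (a + (m + (a + t))) = a + refl_parts xs (m + (a + refl_parts ys t))"
      using ge[OF that, of ys] by (simp del: refl_parts.simps add: f_def g_def refl_parts_add)
    show "g (m + (a + t)) = refl_parts xs (m + (a + refl_parts ys t))"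
      using that by (simp del: refl_parts.simps add: f_def g_def refl_parts_add)
  qed
  have split: "1 \<le> x \<and> x \<le> a \<or> (\<exists>t. x = a + t \<and> 1 \<le> t \<and> t \<le> m) \<or>
      (\<exists>t. x = a + (m + t) \<and> 1 \<le> t \<and> t \<le> a) \<or> (\<exists>t. x = a + (m + (a + t)) \<and> 1 \<le> t)"
    if "x \<in> ?A" for x
    using that by simp presburger
  have "ncyc ?A f = ncyc ?B g"
  proof (rule ncyc_eq[where r = ?r and i = ?i])
    fix x assume x: "x \<in> ?A"
    then show rx: "?r x \<in> ?B"
      using s by auto
    consider "1 \<le> x" "x \<le> a" | t where "x = a + t" "1 \<le> t" "t \<le> m"
      | t where "x = a + (m + t)" "1 \<le> t" "t \<le> a" | t where "x = a + (m + (a + t))" "1 \<le> t"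
      using split[OF x] by blast
    then have "?r (f x) = ?r x \<or> ?r (f x) = g (?r x)"
    proof cases
      case 1
      then have "1 \<le> m + (a + 1 - x)"
        by linarith
      then have "\<not> refl_parts xs (m + (a + 1 - x)) \<le> 0"
        by (rule ge)
      then show ?thesis
        unfolding f_left[OF 1] using g_left[OF 1] 1 by simp
    next
      case (2 t)
      then have "1 \<le> m + 1 - t"
        by linarith
      then have "\<not> refl_parts xs (m + 1 - t) \<le> 0"
        by (rule ge)
      then show ?thesis
        using f_mid[OF 2(2,3)] g_mid[OF 2(2,3)] 2 by simp
    next
      case (3 t)
      then show ?thesis
        using f_right[OF 3(2,3)] by simp
    next
      case (4 t)
      then show ?thesis
        using f_out[OF 4(2)] g_out[OF 4(2)] ge[of "m + (a + refl_parts ys t)" xs] ge[of t ys] by simp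
    qed
    then show "conn ?B g (?r x) (?r (f x))"
      using conn_step[OF rx, of g] by (metis conn_refl)
    consider "1 \<le> x" "x \<le> a" | t where "x = a + t" "1 \<le> t" "t \<le> m"
      | t where "x = a + (m + t)" "1 \<le> t" "t \<le> a" | t where "x = a + (m + (a + t))" "1 \<le> t"
      using split[OF x] by blast
    \<comment> \<open>A surviving vertex is recovered exactly, a deleted one is the
      \<open>f\<close>-image of its representative in the third block.\<close>
    then have "?i (?r x) = x \<or> f (?i (?r x)) = x"
      by cases (use f_right in auto)
    moreover have "?i (?r x) \<in> ?A"
      using rx by auto
    ultimately show "conn ?A f (?i (?r x)) x"
      using conn_step[of "?i (?r x)" ?A f] by (metis conn_refl)
  next
    fix y assume y: "y \<in> ?B"
    then show iy: "?i y \<in> ?A"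
      by auto
    then have fi: "conn ?A f (?i y) (f (?i y))"
      by (rule conn_step)
    consider "1 \<le> ?i y" "?i y \<le> a" | t where "?i y = a + t" "1 \<le> t" "t \<le> m"
      | t where "?i y = a + (m + t)" "1 \<le> t" "t \<le> a" | t where "?i y = a + (m + (a + t))" "1 \<le> t"
      using split[OF iy] by blast
    then show "conn ?A f (?i y) (?i (g y))"
    proof cases
      case 1
      then show ?thesis
        using y by simp
    next
      case (2 t)
      then show ?thesis
        using f_mid[OF 2(2,3)] g_mid[OF 2(2,3)] fi by simp
    next
      case (3 t)
      \<comment> \<open>From the third block \<open>f\<close> passes through the deleted block, so
        one step of \<open>g\<close> corresponds to two steps of \<open>f\<close>.\<close>
      then have "f (f (?i y)) = ?i (g y)"
        using f_right[OF 3(2,3)] f_left[OF 3(2,3)] g_left[OF 3(2,3)] by simp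
      moreover have "f (?i y) \<in> ?A"
        using f_right[OF 3(2,3)] 3 by simp
      ultimately show ?thesis
        using fi conn_step[of "f (?i y)" ?A f] conn_trans by metis
    next
      case (4 t)
      then show ?thesis
        using f_out[OF 4(2)] g_out[OF 4(2)] fi by simp
    qed
    show "conn ?B g (?r (?i y)) y"
      using y by simp
  qed auto
  then show ?thesis
    by (simp add: cyc_index_def m_def f_def g_def)
qed

lemma cyc_index_reduce_big:
  assumes ab: "a \<le> b" "b \<le> 2 * a" and sums: "a + sum_list xs = b + sum_list ys"
  shows "cyc_index (a # xs) (b # ys) = cyc_index ((2 * a - b) # xs) (a # ys)"
proof -
  define d m where "d = b - a" and "m = 2 * a - b"
  have a: "a = m + d" and b: "b = m + d + d" and s: "sum_list xs = d + sum_list ys"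
    using ab sums by (auto simp: d_def m_def)
  let ?n = "sum_list xs"
  let ?A = "{1..a + ?n}"
  let ?B = "{1..m + ?n}"
  \<comment> \<open>Since \<open>f (d + t) = t\<close> for \<open>1 \<le> t\<close> and
    \<open>t \<le> a\<close>, a deleted vertex \<open>v \<le> d\<close> is represented by
    \<open>d + v\<close>, which becomes \<open>v\<close> again after subtraction of
    \<open>d\<close>.\<close>
  let ?r = "\<lambda>v. if v \<le> d then v else v - d" and ?i = "\<lambda>v. d + v"
  define f g where "f = refl_parts (a # xs) \<circ> refl_parts (b # ys)"
    and "g = refl_parts (m # xs) \<circ> refl_parts (a # ys)"
  have ge: "1 \<le> refl_parts zs v" "\<not> refl_parts zs v \<le> 0" if "1 \<le> v" for v zs
    using refl_parts_gt[OF that, of zs] by auto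
  have f_left: "f x = d + (m + refl_parts xs (d + 1 - x))"
    and g_left: "g x = m + refl_parts xs (d + 1 - x)" if "1 \<le> x" "x \<le> d" for x
  proof -
    have "refl_parts (b # ys) x = a + (d + 1 - x)"
      using that a b by (simp add: refl_parts_le)
    then have "f x = a + refl_parts xs (d + 1 - x)"
      using that refl_parts_add[of "d + 1 - x" a xs] by (simp only: f_def g_def o_apply)
    then show "f x = d + (m + refl_parts xs (d + 1 - x))"
      using a by simp
    have "refl_parts (a # ys) x = m + (d + 1 - x)"
      using that a by (simp add: refl_parts_le)
    then show "g x = m + refl_parts xs (d + 1 - x)"
      using that refl_parts_add[of "d + 1 - x" m xs] by (simp only: f_def g_def o_apply)
  qed
  have f_mid: "f (d + t) = t" if "1 \<le> t" "t \<le> a" for t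
  proof -
    have "refl_parts (b # ys) (d + t) = a + 1 - t"
      using that a b by (simp add: refl_parts_le)
    then show ?thesis
      using that refl_parts_rev[of t a xs] by (simp only: f_def g_def o_apply)
  qed
  have g_mid: "g (d + t) = t" if "1 \<le> t" "t \<le> m" for t
  proof -
    have "refl_parts (a # ys) (d + t) = m + 1 - t"
      using that a by (simp add: refl_parts_le)
    then show ?thesis
      using that refl_parts_rev[of t m xs] by (simp only: f_def g_def o_apply)
  qed
  have f_out: "f (d + (a + t)) = d + (m + refl_parts xs (d + refl_parts ys t))"
    and g_out: "g (a + t) = m + refl_parts xs (d + refl_parts ys t)" if "1 \<le> t" for t
  proof -
    have "d + (a + t) = b + t"
      using a b by simp
    then have "refl_parts (b # ys) (d + (a + t)) = b + refl_parts ys t"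
      using that by (simp only: refl_parts_add)
    also have "\<dots> = a + (d + refl_parts ys t)"
      using a b by simp
    finally show "f (d + (a + t)) = d + (m + refl_parts xs (d + refl_parts ys t))"
      using ge[OF that, of ys] a by (simp del: refl_parts.simps add: f_def g_def refl_parts_add)
    have "refl_parts (a # ys) (a + t) = m + (d + refl_parts ys t)"
      using that a by (simp only: refl_parts_add)
    then show "g (a + t) = m + refl_parts xs (d + refl_parts ys t)"
      using ge[OF that, of ys] by (simp del: refl_parts.simps add: f_def g_def refl_parts_add)
  qed
  have split: "1 \<le> x \<and> x \<le> d \<or> (\<exists>t. x = d + t \<and> 1 \<le> t \<and> t \<le> a) \<or>
      (\<exists>t. x = d + (a + t) \<and> 1 \<le> t)" if "x \<in> ?A" for x
    using that by simp presburger
  have "ncyc ?A f = ncyc ?B g"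
  proof (rule ncyc_eq[where r = ?r and i = ?i])
    fix x assume x: "x \<in> ?A"
    then show rx: "?r x \<in> ?B"
      using a s by auto
    consider "1 \<le> x" "x \<le> d" | t where "x = d + t" "1 \<le> t" "t \<le> a"
      | t where "x = d + (a + t)" "1 \<le> t"
      using split[OF x] by blast
    then have "?r (f x) = ?r x \<or> ?r (f x) = g (?r x)"
    proof cases
      case 1
      then have "1 \<le> d + 1 - x"
        by linarith
      then have "\<not> refl_parts xs (d + 1 - x) \<le> 0"
        by (rule ge)
      then show ?thesis
        unfolding f_left[OF 1] using g_left[OF 1] 1 by simp
    next
      case (2 t)
      show ?thesis
      \<comment> \<open>If \<open>t \<le> d\<close>, then the image \<open>t\<close> of
        \<open>d + t\<close> is deleted and represented by \<open>d + t\<close> itself; otherwise it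
        survives as \<open>t - d\<close>, which is \<open>g t\<close>.\<close>
      proof (cases "t \<le> d")
        case True
        then show ?thesis
          using f_mid[OF 2(2,3)] 2 by simp
      next
        case False
        then have "t = d + (t - d)" "1 \<le> t - d" "t - d \<le> m"
          using 2 a by auto
        then have "g t = t - d"
          using g_mid[of "t - d"] by metis
        then show ?thesis
          using f_mid[OF 2(2,3)] 2 False by simp
      qed
    next
      case (3 t)
      then show ?thesis
        using f_out[OF 3(2)] g_out[OF 3(2)] ge[of "d + refl_parts ys t" xs] ge[of t ys] by simp
    qed
    then show "conn ?B g (?r x) (?r (f x))"
      using conn_step[OF rx, of g] by (metis conn_refl)
    consider "1 \<le> x" "x \<le> d" | t where "x = d + t" "1 \<le> t" "t \<le> a"
      | t where "x = d + (a + t)" "1 \<le> t"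
      using split[OF x] by blast
    then have "?i (?r x) = x \<or> f (?i (?r x)) = x"
      by cases (use f_mid a in auto)
    moreover have "?i (?r x) \<in> ?A"
      using rx a by auto
    ultimately show "conn ?A f (?i (?r x)) x"
      using conn_step[of "?i (?r x)" ?A f] by (metis conn_refl)
  next
    fix y assume y: "y \<in> ?B"
    then show iy: "?i y \<in> ?A"
      using a by auto
    then have fi: "conn ?A f (?i y) (f (?i y))"
      by (rule conn_step)
    consider "1 \<le> ?i y" "?i y \<le> d" | t where "?i y = d + t" "1 \<le> t" "t \<le> a"
      | t where "?i y = d + (a + t)" "1 \<le> t"
      using split[OF iy] by blast
    then show "conn ?A f (?i y) (?i (g y))"
    proof cases
      case 1
      then show ?thesis
        using y by simp
    next
      case (2 t)
      then have f: "f (?i y) = y"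
        using f_mid[OF 2(2,3)] by simp
      show ?thesis
      proof (cases "y \<le> d")
        case True
        \<comment> \<open>As \<open>y\<close> is deleted here, one step of \<open>g\<close> again
          corresponds to two steps of \<open>f\<close>.\<close>
        then have "f y = ?i (g y)"
          using f_left[of y] g_left[of y] y by simp
        moreover have "y \<in> ?A"
          using y a by simp
        ultimately show ?thesis
          using fi conn_step[of y ?A f] conn_trans f by metis
      next
        case False
        then have "y = d + (y - d)" "1 \<le> y - d" "y - d \<le> m"
          using 2 a by auto
        then have "g y = y - d"
          using g_mid[of "y - d"] by metis
        then show ?thesis
          using fi f False by simp
      qed
    next
      case (3 t)
      then show ?thesis
        using f_out[OF 3(2)] g_out[OF 3(2)] fi by simp
    qed
    show "conn ?B g (?r (?i y)) y"
      using y by simp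
  qed auto
  then show ?thesis
    by (simp add: cyc_index_def m_def f_def g_def)
qed

text \<open>Vertex \<open>v\<close> becomes the block of the vertices
  \<open>c * (v - 1) + j\<close>. Reflecting an enlarged part permutes the blocks as the original
  part permutes its vertices and reverses each block, so offset \<open>j\<close> becomes
  \<open>c + 1 - j\<close>.\<close>

lemma refl_parts_scale:
  assumes "1 \<le> v" "v \<le> sum_list xs" "1 \<le> j" "j \<le> c"
  shows "refl_parts (map ((*) c) xs) (c * (v - 1) + j) = c * (refl_parts xs v - 1) + (c + 1 - j)"
  using assms
proof (induction xs arbitrary: v)
  case (Cons a xs)
  show ?case
  proof (cases "v \<le> a")
    case True
    then obtain w where w: "a = v + w"
      using le_Suc_ex by blast
    obtain u where u: "v = Suc u"
      using Cons.prems by (cases v) auto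
    have "c * u + j \<le> c * a"
      using Cons.prems w u by (simp add: algebra_simps)
    moreover have "c * a + 1 - (c * u + j) = c * (a - v) + (c + 1 - j)"
      using Cons.prems w u by (simp add: algebra_simps)
    ultimately show ?thesis
      using True u w by simp
  next
    case False
    define w where "w = v - a"
    have w: "v = a + w" "1 \<le> w" "w \<le> sum_list xs"
      using False Cons.prems by (auto simp: w_def)
    have e: "c * (v - 1) + j = c * a + (c * (w - 1) + j)"
      using w by (cases w) (auto simp: algebra_simps)
    have IH: "refl_parts (map ((*) c) xs) (c * (w - 1) + j) = c * (refl_parts xs w - 1) + (c + 1 - j)"
      using Cons w by blast
    have "1 \<le> c * (w - 1) + j"
      using Cons.prems by simp
    then have "refl_parts (map ((*) c) (a # xs)) (c * (v - 1) + j) = c * a + refl_parts (map ((*) c) xs) (c * (w - 1) + j)"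
      unfolding e by (simp only: refl_parts.simps list.map) auto
    also have "\<dots> = c * (a + refl_parts xs w - 1) + (c + 1 - j)"
      unfolding IH using refl_parts_gt[OF w(2), of xs] by (cases "refl_parts xs w") (simp_all add: algebra_simps)
    also have "a + refl_parts xs w = refl_parts (a # xs) v"
      using w by simp
    finally show ?thesis .
  qed
qed simp

text \<open>The second reflection undoes the reversal inside the blocks, so the offset
  \<open>j\<close> is invariant, and the vertices of each offset carry one copy of the original
  permutation.\<close>

lemma cyc_index_scale:
  assumes s: "sum_list xs = sum_list ys"
  shows "cyc_index (map ((*) c) xs) (map ((*) c) ys) = c * cyc_index xs ys"
proof -
  let ?n = "sum_list xs"
  let ?f = "refl_parts (map ((*) c) xs) \<circ> refl_parts (map ((*) c) ys)"
  let ?g = "refl_parts xs \<circ> refl_parts ys"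
  define A where "A j = (\<lambda>v. c * (v - 1) + j) ` {1..?n}" for j
  have sum: "sum_list (map ((*) c) xs) = c * ?n"
    by (simp add: sum_list_const_mult)
  have f: "?f (c * (v - 1) + j) = c * (?g v - 1) + j" if "1 \<le> v" "v \<le> ?n" "1 \<le> j" "j \<le> c" for v j
    using that refl_parts_scale[of v ys j c] refl_parts_mem[of v ys] s
      refl_parts_scale[of "refl_parts ys v" xs "c + 1 - j" c] by simp
  have g: "?g v \<in> {1..?n}" if "v \<in> {1..?n}" for v
    using that refl_parts_mem[of v ys] refl_parts_mem[of "refl_parts ys v" xs] s by simp
  \<comment> \<open>Vertices and offsets are numbered from 1, so quotient and remainder are taken of
    the vertex minus 1.\<close>
  have dm: "(c * (v - 1) + j - 1) div c = v - 1" "(c * (v - 1) + j - 1) mod c = j - 1"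
    if "1 \<le> j" "j \<le> c" for v j
  proof -
    have "c * (v - 1) + j - 1 = (j - 1) + c * (v - 1)" "j - 1 < c"
      using that by auto
    then show "(c * (v - 1) + j - 1) div c = v - 1" "(c * (v - 1) + j - 1) mod c = j - 1"
      by simp_all
  qed
  have "{1..c * ?n} = (\<Union>j\<in>{1..c}. A j)"
  proof (intro equalityI subsetI)
    fix x assume x: "x \<in> {1..c * ?n}"
    then have c: "c > 0"
      by (cases c) auto
    define v j where "v = Suc ((x - 1) div c)" and "j = Suc ((x - 1) mod c)"
    have "x = Suc (c * ((x - 1) div c) + (x - 1) mod c)"
      using x by simp
    then have "x = c * (v - 1) + j"
      by (simp add: v_def j_def)
    moreover have "x - 1 < ?n * c"
      using x c by (simp add: mult.commute) linarith
    then have "v \<in> {1..?n}"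
      by (simp add: v_def less_mult_imp_div_less Suc_le_eq)
    moreover have "j \<in> {1..c}"
      using c by (simp add: j_def Suc_le_eq)
    ultimately show "x \<in> (\<Union>j\<in>{1..c}. A j)"
      unfolding A_def by blast
  next
    fix x assume "x \<in> (\<Union>j\<in>{1..c}. A j)"
    then obtain v j where x: "x = c * (v - 1) + j" "v \<in> {1..?n}" "j \<in> {1..c}"
      unfolding A_def by blast
    have "c * (v - 1) + c = c * v"
      using x(2) by (cases v) auto
    moreover have "c * v \<le> c * ?n"
      using x(2) by simp
    moreover have "x \<le> c * (v - 1) + c"
      using x by simp
    ultimately have "x \<le> c * ?n"
      by linarith
    then show "x \<in> {1..c * ?n}"
      using x by simp
  qed
  then have "cyc_index (map ((*) c) xs) (map ((*) c) ys) = ncyc (\<Union>j\<in>{1..c}. A j) ?f"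
    by (simp add: cyc_index_def sum)
  also have "\<dots> = (\<Sum>j\<in>{1..c}. ncyc (A j) ?f)"
  proof (rule ncyc_UN)
    fix i j :: nat assume ij: "i \<in> {1..c}" "j \<in> {1..c}" "i \<noteq> j"
    have "(x - 1) mod c = l - 1" if "x \<in> A l" "l \<in> {1..c}" for x l
      using that dm(2)[of l] by (auto simp: A_def)
    moreover have "i - 1 \<noteq> j - 1"
      using ij by auto
    ultimately show "A i \<inter> A j = {}"
      using ij by (metis disjoint_iff)
  next
    fix j x assume j: "j \<in> {1..c}" and "x \<in> A j"
    then obtain v where v: "x = c * (v - 1) + j" "v \<in> {1..?n}"
      unfolding A_def by blast
    then have "?f x = c * (?g v - 1) + j"
      using f[of v j] j by (simp only: atLeastAtMost_iff)
    then show "?f x \<in> A j"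
      using g[OF v(2)] unfolding A_def by blast
  qed (auto simp: A_def)
  also have "\<dots> = (\<Sum>j\<in>{1..c}. cyc_index xs ys)"
  proof (rule sum.cong)
    fix j assume j: "j \<in> {1..c}"
    show "ncyc (A j) ?f = cyc_index xs ys"
      unfolding cyc_index_def
    proof (rule ncyc_eq[where r = "\<lambda>x. Suc ((x - 1) div c)" and i = "\<lambda>v. c * (v - 1) + j"])
      fix x assume "x \<in> A j"
      then obtain v where v: "x = c * (v - 1) + j" "v \<in> {1..?n}"
        unfolding A_def by blast
      have r: "Suc ((x - 1) div c) = v"
        using dm(1)[of j v] v j by auto
      have fx: "?f x = c * (?g v - 1) + j"
        using f[of v j] v j by simp
      then have "Suc ((?f x - 1) div c) = ?g v"
        using dm(1)[of j "?g v"] g[OF v(2)] j by auto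
      then show "conn {1..?n} ?g (Suc ((x - 1) div c)) (Suc ((?f x - 1) div c))"
        using conn_step[OF v(2), of ?g] r by simp
      show "conn (A j) ?f (c * (Suc ((x - 1) div c) - 1) + j) x"
        using r v by simp
      show "Suc ((x - 1) div c) \<in> {1..?n}"
        using r v by simp
    next
      fix v assume v: "v \<in> {1..?n}"
      then have m: "c * (v - 1) + j \<in> A j"
        by (auto simp: A_def)
      then show "c * (v - 1) + j \<in> A j" .
      show "conn (A j) ?f (c * (v - 1) + j) (c * (?g v - 1) + j)"
        using conn_step[OF m, of ?f] f[of v j] v j by simp
      show "conn {1..?n} ?g (Suc ((c * (v - 1) + j - 1) div c)) v"
        using dm(1)[of j v] v j by auto
    qed (auto simp: A_def)
  qed simp
  finally show ?thesis
    by simp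
qed

subsection \<open>Components of a pair of involutions\<close>

fun flip :: "side \<Rightarrow> side" where
  "flip Upper = Lower"
| "flip Lower = Upper"

lemma flip_flip [simp]: "flip (flip s) = s"
  by (cases s) auto

lemma flip_neq [simp]: "flip s \<noteq> s" "s \<noteq> flip s"
  by (cases s; simp)+

lemma side_eq_iff: "s' = s \<or> s' = flip s"
  by (cases s; cases s') auto

text \<open>A fixed point of \<open>g s\<close> stands for a vertex without an edge on side
  \<open>s\<close>. Every vertex then has at most one edge per side, and this alone determines the
  shape of the components.\<close>

locale two_involutions =
  fixes V :: "nat set" and g :: "side \<Rightarrow> nat \<Rightarrow> nat"
  assumes fin: "finite V"
    and g_mem [simp]: "v \<in> V \<Longrightarrow> g s v \<in> V"
    and g_invol [simp]: "v \<in> V \<Longrightarrow> g s (g s v) = v"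
begin

text \<open>Ordering the ends makes both of them yield the same edge and agrees with
  \<open>part_edges\<close>, whose pairs are increasing.\<close>

definition edge :: "side \<Rightarrow> nat \<Rightarrow> edge" where
  "edge s u = (s, min u (g s u), max u (g s u))"

definition E :: "edge set" where
  "E = {edge s u | s u. u \<in> V \<and> g s u \<noteq> u}"

text \<open>This is the relation inside \<open>components\<close>, so that the components are
  literally \<open>V // linked\<close>.\<close>

definition linked :: "(nat \<times> nat) set" where
  "linked = {(u, v). u \<in> V \<and> v \<in> V \<and> (u, v) \<in> {(x, y). \<exists>e\<in>E. ends e = {x, y}}\<^sup>*}"

definition turn :: "nat \<Rightarrow> nat" where
  "turn = g Upper \<circ> g Lower"

lemma ends_edge [simp]: "ends (edge s u) = {u, g s u}"
  by (auto simp: edge_def min_def max_def)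

lemma edge_mem: "u \<in> V \<Longrightarrow> g s u \<noteq> u \<Longrightarrow> edge s u \<in> E"
  by (auto simp: E_def)

lemma edge_eqD: "edge s u = edge s' u' \<Longrightarrow> s' = s \<and> (u' = u \<or> u' = g s u)"
  by (auto simp: edge_def min_def max_def split: if_splits)

lemma edge_other: "u \<in> V \<Longrightarrow> edge s (g s u) = edge s u"
  by (simp add: edge_def min.commute max.commute)

lemma equiv_linked: "equiv V linked"
proof -
  have "sym ({(x, y). \<exists>e\<in>E. ends e = {x, y}}\<^sup>*)"
    by (rule sym_rtrancl) (auto simp: sym_def insert_commute)
  then show ?thesis
    by (intro equivI) (auto simp: linked_def refl_on_def sym_def trans_def)
qed

lemma linked_g: "(u, v) \<in> linked \<Longrightarrow> (u, g s v) \<in> linked"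
proof (cases "g s v = v")
  case False
  assume uv: "(u, v) \<in> linked"
  then have "edge s v \<in> E"
    using False by (auto simp: E_def linked_def)
  then have "(v, g s v) \<in> {(x, y). \<exists>e\<in>E. ends e = {x, y}}"
    by (auto intro!: bexI[of _ "edge s v"])
  with uv show ?thesis
    by (auto simp: linked_def intro: rtrancl_into_rtrancl)
qed simp

lemma linked_g_iff: "v \<in> V \<Longrightarrow> (u, g s v) \<in> linked \<longleftrightarrow> (u, v) \<in> linked"
  using linked_g[of u v s] linked_g[of u "g s v" s] by (metis g_invol)

lemma edges_atE:
  assumes "e \<in> edges_at E (linked `` {v})"
  obtains s u where "e = edge s u" "u \<in> V" "g s u \<noteq> u" "(v, u) \<in> linked"
proof -
  obtain s u where su: "e = edge s u" "u \<in> V" "g s u \<noteq> u"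
    using assms unfolding edges_at_def E_def by blast
  have "ends e \<inter> linked `` {v} \<noteq> {}"
    using assms by (simp add: edges_at_def)
  then have "(v, u) \<in> linked"
    using su linked_g_iff by auto
  with su show thesis
    by (rule that)
qed

text \<open>Induction over a component: it shows that a walk closed under both involutions exhausts
  the component of its start.\<close>

lemma linked_closed:
  assumes "(u, v) \<in> linked" "u \<in> S" "\<And>s x. x \<in> S \<Longrightarrow> x \<in> V \<Longrightarrow> g s x \<in> S"
  shows "v \<in> S"
proof -
  have "(u, v) \<in> {(x, y). \<exists>e\<in>E. ends e = {x, y}}\<^sup>*" "u \<in> V"
    using assms(1) by (auto simp: linked_def)
  then have "v \<in> S \<and> v \<in> V"
  proof (induction rule: rtrancl_induct)
    case (step y z)
    then obtain e where "e \<in> E" "ends e = {y, z}"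
      by blast
    then obtain s x where "x \<in> V" "{x, g s x} = {y, z}"
      unfolding E_def using ends_edge by blast
    then have "z = g s y"
      by (metis doubleton_eq_iff g_invol)
    with step show ?case
      using assms(3) by auto
  qed (use assms in auto)
  then show ?thesis ..
qed

text \<open>For \<open>s = Lower\<close> the point reached is the preimage of \<open>u\<close> under
  \<open>turn\<close>.\<close>

lemma conn_turn: "u \<in> V \<Longrightarrow> conn V turn u (g s (g (flip s) u))"
proof (cases s)
  case Upper
  then show "u \<in> V \<Longrightarrow> conn V turn u (g s (g (flip s) u))"
    using conn_step[of u V turn] by (simp add: turn_def)
next
  case Lower
  then show "u \<in> V \<Longrightarrow> conn V turn u (g s (g (flip s) u))"
    using conn_step[of "g s (g (flip s) u)" V turn] conn_sym by (fastforce simp: turn_def)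
qed

lemma orbit_rel_linked: "orbit_rel V turn \<subseteq> linked"
proof clarify
  fix u v assume uv: "(u, v) \<in> orbit_rel V turn"
  have "((u, turn x) \<in> linked) = ((u, x) \<in> linked)" if "x \<in> V" for x
    using that by (simp add: turn_def linked_g_iff)
  then have "((u, u) \<in> linked) = ((u, v) \<in> linked)"
    using conn_invariant[of V turn u v "\<lambda>x. (u, x) \<in> linked"] uv unfolding orbit_rel_def by blast
  moreover have "(u, u) \<in> linked"
    using uv by (auto simp: linked_def orbit_rel_def)
  ultimately show "(u, v) \<in> linked"
    by simp
qed

section \<open>Alternating walks along a component\<close>

definition alt :: "side \<Rightarrow> nat \<Rightarrow> side" where
  "alt s k = (if even k then s else flip s)"

primrec walk :: "side \<Rightarrow> nat \<Rightarrow> nat \<Rightarrow> nat" where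
  "walk s v 0 = v"
| "walk s v (Suc k) = g (alt s k) (walk s v k)"

lemma alt_simps [simp]: "alt s 0 = s" "alt s (Suc k) = flip (alt s k)"
  by (auto simp: alt_def)

lemma alt_eq_iff: "alt s i = alt s j \<longleftrightarrow> even i = even j"
  by (auto simp: alt_def)

lemma walk_mem [simp]: "v \<in> V \<Longrightarrow> walk s v k \<in> V"
  by (induction k) auto

lemma walk_back: "v \<in> V \<Longrightarrow> g (alt s k) (walk s v (Suc k)) = walk s v k"
  by simp

lemma walk_linked: "v \<in> V \<Longrightarrow> (v, walk s v k) \<in> linked"
proof (induction k)
  case 0
  then show ?case by (simp add: linked_def)
qed (auto intro: linked_g)

lemma first_repeat:
  assumes "v \<in> V"
  obtains N where "inj_on (walk s v) {..N}" "walk s v (Suc N) \<in> walk s v ` {..N}"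
proof -
  let ?P = "\<lambda>N. walk s v (Suc N) \<in> walk s v ` {..N}"
  have inj: "inj_on (walk s v) {..N}" if "\<And>i. i < N \<Longrightarrow> \<not> ?P i" for N
    using that
  proof (induction N)
    case (Suc N)
    then have "inj_on (walk s v) {..N}" "walk s v (Suc N) \<notin> walk s v ` {..N}"
      by auto
    then show ?case
      by (simp add: atMost_Suc del: walk.simps)
  qed simp
  have "\<exists>N. ?P N"
  proof (rule ccontr)
    assume "\<nexists>N. ?P N"
    then have "inj_on (walk s v) {..card V}"
      using inj by blast
    then have "card {..card V} \<le> card V"
      by (rule card_inj_on_le) (use assms fin in auto)
    then show False
      by simp
  qed
  then have "?P (LEAST N. ?P N)"
    by (rule LeastI_ex)
  then show thesis
    using that[of "LEAST N. ?P N"] inj[of "LEAST N. ?P N"] not_less_Least by blast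
qed

text \<open>At a vertex after the start the walk has used the edges of both sides, so a return to it
  along either of them contradicts injectivity or the alternation of sides. What remains is standing
  still at the end of a path, or returning to the start on the side other than \<open>s\<close>,
  which makes \<open>N\<close> odd.\<close>

lemma repeat_cases:
  assumes v: "v \<in> V" and inj: "inj_on (walk s v) {..N}"
    and rep: "walk s v (Suc N) \<in> walk s v ` {..N}"
  shows "walk s v (Suc N) = walk s v N \<or> odd N \<and> walk s v (Suc N) = v"
proof -
  obtain j where j: "j \<le> N" "walk s v (Suc N) = walk s v j"
    using rep by auto
  have N: "g (alt s N) (walk s v j) = walk s v N"
    using walk_back[OF v, of s N] j by simp
  have eq: "i = N" if "walk s v i = walk s v N" "i \<le> N" for i
    using inj that by (auto dest: inj_onD)
  show ?thesis
  proof (cases "j = N")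
    case False
    then have "j < N"
      using j by simp
    have odd: "alt s N \<noteq> alt s j"
    proof
      assume a: "alt s N = alt s j"
      then have "Suc j = N"
        using N eq[of "Suc j"] \<open>j < N\<close> by simp
      then show False
        using a by auto
    qed
    have "j = 0"
    proof (rule ccontr)
      assume "j \<noteq> 0"
      then obtain i where i: "j = Suc i"
        by (cases j) auto
      then have "alt s N = alt s i"
        using odd side_eq_iff[of "alt s N" "alt s i"] by auto
      then have "i = N"
        using N eq[of i] walk_back[OF v, of s i] i j(1) by simp
      then show False
        using i j(1) by simp
    qed
    then show ?thesis
      using odd j alt_eq_iff[of s N 0] by auto
  qed (use j in simp)
qed

text \<open>A path has one vertex more than edges, a cycle has equally many.\<close>

lemma not_path_and_cycle: "is_path E C \<Longrightarrow> \<not> is_cycle E C"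
proof
  assume "is_path E C" "is_cycle E C"
  then obtain vs es vs' es' where *: "distinct vs" "set vs = C" "distinct es" "set es = edges_at E C"
    "length vs = Suc (length es)" "distinct vs'" "set vs' = C" "distinct es'" "set es' = edges_at E C"
    "length es' = length vs'"
    unfolding is_path_def is_cycle_def by metis
  then show False
    by (metis distinct_card n_not_Suc_n)
qed

text \<open>\<open>v\<close> is an end of the path: it has no edge on the side
  \<open>flip s\<close>, and the walk that leaves on side \<open>s\<close> runs to the other end,
  where it stands still.\<close>

lemma quotient_path:
  assumes v: "v \<in> V" and C: "C = linked `` {v}"
    and inj: "inj_on (walk s v) {..N}" and fix1: "g (flip s) v = v"
    and fix2: "walk s v (Suc N) = walk s v N"
  shows "is_path E C \<and> card (C // orbit_rel V turn) = 1"
proof -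
  let ?w = "walk s v"
  have closed: "g s' (?w i) \<in> ?w ` {..N}" if "i \<le> N" for s' i
  proof (cases "s' = alt s i")
    case True
    then have "g s' (?w i) = ?w (Suc i)"
      by simp
    then show ?thesis
      using that fix2 by (cases "i = N") (auto simp del: walk.simps)
  next
    case False
    then show ?thesis
    proof (cases i)
      case (Suc k)
      then have "g s' (?w i) = ?w k"
        using False side_eq_iff[of s' "alt s i"] walk_back[OF v, of s k] by auto
      then show ?thesis
        using Suc that by auto
    next
      case 0
      then have "g s' (?w i) = ?w 0"
        using False side_eq_iff[of s' s] fix1 by auto
      then show ?thesis
        by (metis atMost_iff image_eqI le0)
    qed
  qed
  have CS: "C = ?w ` {..N}"
  proof (intro equalityI subsetI)
    fix x assume x: "x \<in> C"
    show "x \<in> ?w ` {..N}"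
    proof (rule linked_closed)
      show "(v, x) \<in> linked"
        using x C by simp
      show "v \<in> ?w ` {..N}"
        by (rule image_eqI[of _ _ 0]) simp_all
      show "g s' y \<in> ?w ` {..N}" if "y \<in> ?w ` {..N}" for s' y
        using that closed by blast
    qed
  qed (use walk_linked[OF v] C in auto)
  have edges: "\<exists>j<N. edge s' (?w i) = edge (alt s j) (?w j)"
    if neq: "g s' (?w i) \<noteq> ?w i" and i: "i \<le> N" for s' i
  proof (cases "s' = alt s i")
    case True
    then have "i \<noteq> N"
      using neq fix2 by auto
    then show ?thesis
      using True i le_neq_implies_less by blast
  next
    case False
    then have s': "s' = flip (alt s i)"
      using side_eq_iff[of s' "alt s i"] by simp
    then obtain k where k: "i = Suc k"
      using neq fix1 by (cases i) auto
    then have "edge s' (?w i) = edge (alt s k) (?w k)"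
      using s' edge_other[of "?w k" s'] v by simp
    then show ?thesis
      using k i by (metis Suc_le_eq)
  qed
  have neq: "g (alt s i) (?w i) \<noteq> ?w i" if "i < N" for i
    using inj_onD[OF inj, of "Suc i" i] that by auto
  have "set (map (\<lambda>i. edge (alt s i) (?w i)) [0..<N]) = edges_at E C"
  proof (intro equalityI subsetI)
    fix e assume "e \<in> set (map (\<lambda>i. edge (alt s i) (?w i)) [0..<N])"
    then obtain i where i: "i < N" "e = edge (alt s i) (?w i)"
      by auto
    then have "e \<in> E"
      using neq[OF i(1)] v by (simp add: edge_mem)
    then show "e \<in> edges_at E C"
      using i CS by (auto simp: edges_at_def)
  next
    fix e assume "e \<in> edges_at E C"
    then obtain s' u where u: "e = edge s' u" "u \<in> V" "g s' u \<noteq> u" "(v, u) \<in> linked"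
      unfolding C by (rule edges_atE)
    then obtain i where "i \<le> N" "u = ?w i"
      using C CS by auto
    then obtain j where "j < N" "e = edge (alt s j) (?w j)"
      using u edges[of s' i] by blast
    then show "e \<in> set (map (\<lambda>i. edge (alt s i) (?w i)) [0..<N])"
      by simp
  qed
  moreover have "distinct (map (\<lambda>i. edge (alt s i) (?w i)) [0..<N])"
  proof -
    have "i = j" if ij: "i < N" "j < N" and e: "edge (alt s i) (?w i) = edge (alt s j) (?w j)" for i j
    proof -
      have "?w j = ?w i \<or> ?w j = ?w (Suc i)" "even j = even i"
        using edge_eqD[OF e] alt_eq_iff by auto
      then show ?thesis
        using ij inj_onD[OF inj, of j i] inj_onD[OF inj, of j "Suc i"] by auto
    qed
    then show ?thesis
      by (auto simp: distinct_map inj_on_def)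
  qed
  moreover have "distinct (map ?w [0..<Suc N])" "set (map ?w [0..<Suc N]) = C"
    using inj CS by (auto simp: distinct_map inj_on_def simp del: upt_Suc walk.simps)
  ultimately have path: "is_path E C"
    unfolding is_path_def
    by (intro exI[of _ "map ?w [0..<Suc N]"] exI[of _ "map (\<lambda>i. edge (alt s i) (?w i)) [0..<N]"])
      (simp del: upt_Suc)
  have step2: "conn V turn (?w i) (?w (Suc (Suc i)))" for i
    using conn_turn[of "?w i" "flip (alt s i)"] v by simp
  \<comment> \<open>Two steps of the walk are a turn in one of the two directions. Because
    \<open>g (flip s)\<close> fixes \<open>v\<close>, the first single step is such a turn as well,
    and this merges even and odd positions into one orbit.\<close>
  have conn: "conn V turn v (?w i) \<and> conn V turn v (?w (Suc i))" for i
  proof (induction i)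
    case 0
    then show ?case
      using conn_turn[of v s] v fix1 by simp
  next
    case (Suc i)
    then show ?case
      using conn_trans[OF conjunct1[OF Suc] step2[of i]] by (simp del: walk.simps)
  qed
  have "orbit_rel V turn `` {x} = orbit_rel V turn `` {v}" if x: "x \<in> C" for x
  proof -
    obtain i where "x = ?w i"
      using x CS by blast
    then have "(v, x) \<in> orbit_rel V turn"
      using conn[of i] v by (simp add: orbit_rel_def)
    then show ?thesis
      by (rule equiv_class_eq[OF equiv_orbit_rel, symmetric])
  qed
  moreover have "v \<in> C"
    using walk_linked[OF v, of s 0] C by auto
  ultimately have "C // orbit_rel V turn = {orbit_rel V turn `` {v}}"
    unfolding quotient_def by blast
  with path show ?thesis
    by simp
qed

text \<open>The even positions form one orbit and the odd positions the other. As \<open>N\<close>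
  is odd, the closing edge changes the parity too.\<close>

lemma quotient_cycle:
  assumes v: "v \<in> V" and C: "C = linked `` {v}"
    and inj: "inj_on (walk s v) {..N}" and N: "odd N" and closes: "walk s v (Suc N) = v"
  shows "is_cycle E C \<and> card (C // orbit_rel V turn) = 2"
proof -
  let ?w = "walk s v"
  have altN: "alt s N = flip s"
    using N by (simp add: alt_def)
  have start: "g (flip s) v = ?w N"
    using walk_back[OF v, of s N] closes altN by simp
  have nb: "\<exists>j\<le>N. g s' (?w i) = ?w j \<and> even j \<noteq> even i \<and>
      (\<exists>k\<le>N. edge s' (?w i) = edge (alt s k) (?w k))" if "i \<le> N" for s' i
  proof (cases "s' = alt s i")
    case True
    then have "g s' (?w i) = ?w (Suc i)"
      by simp
    then have "\<exists>j\<le>N. g s' (?w i) = ?w j \<and> even j \<noteq> even i"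
    proof (cases "i = N")
      case True
      then have "g s' (?w i) = ?w 0"
        using \<open>g s' (?w i) = ?w (Suc i)\<close> closes by simp
      then show ?thesis
        using True N by (intro exI[of _ 0]) simp
    next
      case False
      then show ?thesis
        using \<open>g s' (?w i) = ?w (Suc i)\<close> that by (intro exI[of _ "Suc i"]) simp
    qed
    then show ?thesis
      using True that by blast
  next
    case False
    then have s': "s' = flip (alt s i)"
      using side_eq_iff[of s' "alt s i"] by simp
    show ?thesis
    proof (cases i)
      case (Suc k)
      then have "s' = alt s k"
        using s' by simp
      then have "g s' (?w i) = ?w k" "edge s' (?w i) = edge (alt s k) (?w k)"
        using Suc edge_other[of "?w k" s'] v by simp_all
      moreover have "k \<le> N" "even k \<noteq> even i"
        using Suc that by auto
      ultimately show ?thesis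
        by blast
    next
      case 0
      then have "edge s' (?w i) = edge (alt s N) (?w N)"
        using s' start altN edge_other[OF v, of "flip s"] by simp
      then show ?thesis
        using s' 0 start N by (intro exI[of _ N]) auto
    qed
  qed
  have CS: "C = ?w ` {..N}"
  proof (intro equalityI subsetI)
    fix x assume x: "x \<in> C"
    show "x \<in> ?w ` {..N}"
    proof (rule linked_closed)
      show "(v, x) \<in> linked"
        using x C by simp
      show "v \<in> ?w ` {..N}"
        by (rule image_eqI[of _ _ 0]) simp_all
      show "g s' y \<in> ?w ` {..N}" if "y \<in> ?w ` {..N}" for s' y
        using that nb by blast
    qed
  qed (use walk_linked[OF v] C in auto)
  have neq: "g s' (?w i) \<noteq> ?w i" if i: "i \<le> N" for i s'
  proof -
    obtain j where "j \<le> N" "g s' (?w i) = ?w j" "even j \<noteq> even i"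
      using nb[OF i] by blast
    then show ?thesis
      using inj_onD[OF inj, of i j] i by auto
  qed
  have "set (map (\<lambda>i. edge (alt s i) (?w i)) [0..<Suc N]) = edges_at E C"
  proof (intro equalityI subsetI)
    fix e assume "e \<in> set (map (\<lambda>i. edge (alt s i) (?w i)) [0..<Suc N])"
    then obtain i where i: "i \<le> N" "e = edge (alt s i) (?w i)"
      by (auto simp del: upt_Suc simp: less_Suc_eq_le)
    then have "e \<in> E"
      using neq[OF i(1)] v by (simp add: edge_mem)
    then show "e \<in> edges_at E C"
      using i CS by (auto simp: edges_at_def)
  next
    fix e assume "e \<in> edges_at E C"
    then obtain s' u where u: "e = edge s' u" "u \<in> V" "g s' u \<noteq> u" "(v, u) \<in> linked"
      unfolding C by (rule edges_atE)
    then obtain i where "i \<le> N" "u = ?w i"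
      using C CS by auto
    then show "e \<in> set (map (\<lambda>i. edge (alt s i) (?w i)) [0..<Suc N])"
      using u nb[of i s'] by (auto simp: less_Suc_eq_le simp del: upt_Suc)
  qed
  moreover have "distinct (map (\<lambda>i. edge (alt s i) (?w i)) [0..<Suc N])"
  proof -
    have "i = j" if ij: "i \<le> N" "j \<le> N" and e: "edge (alt s i) (?w i) = edge (alt s j) (?w j)" for i j
    proof -
      have "?w j = ?w i \<or> ?w j = ?w (Suc i)" and ev: "even j = even i"
        using edge_eqD[OF e] alt_eq_iff by auto
      moreover have "?w j \<noteq> ?w (Suc i)"
      proof (cases "i = N")
        case True
        then show ?thesis
          using inj_onD[OF inj, of j 0] ij closes N ev by auto
      next
        case False
        then show ?thesis
          using inj_onD[OF inj, of j "Suc i"] ij ev by (auto simp del: walk.simps)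
      qed
      ultimately show ?thesis
        using ij inj_onD[OF inj, of j i] by auto
    qed
    then show ?thesis
      by (auto simp: distinct_map inj_on_def less_Suc_eq_le simp del: upt_Suc)
  qed
  moreover have "distinct (map ?w [0..<Suc N])" "set (map ?w [0..<Suc N]) = C"
    using inj CS by (auto simp: distinct_map inj_on_def simp del: upt_Suc walk.simps)
  moreover have "g (alt s i) (?w i) = ?w (Suc i mod Suc N)" if "i < Suc N" for i
    using that closes by (cases "i = N") auto
  moreover have "2 \<le> Suc N"
    using N by (cases N) auto
  ultimately have cycle: "is_cycle E C"
    unfolding is_cycle_def
    by (intro exI[of _ "map ?w [0..<Suc N]"] exI[of _ "map (\<lambda>i. edge (alt s i) (?w i)) [0..<Suc N]"])
      (simp del: upt_Suc walk.simps)
  let ?R = "orbit_rel V turn"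
  have step2: "conn V turn (?w i) (?w (Suc (Suc i)))" for i
    using conn_turn[of "?w i" "flip (alt s i)"] v by simp
  have conn: "conn V turn (?w (if even i then 0 else 1)) (?w i)" for i
  proof (induction i rule: induct_nat_012)
    case (ge2 i)
    then show ?case
      using step2[of i] conn_trans by (auto simp del: walk.simps)
  qed auto
  have class_eq: "?R `` {?w i} = ?R `` {?w (if even i then 0 else 1)}" for i
  proof -
    have "(?w (if even i then 0 else 1), ?w i) \<in> ?R"
      using conn[of i] walk_mem[OF v, of s] unfolding orbit_rel_def by blast
    then show ?thesis
      by (rule equiv_class_eq[OF equiv_orbit_rel, symmetric])
  qed
  have "C // ?R = {?R `` {?w 0}, ?R `` {?w 1}}"
  proof (intro equalityI subsetI)
    fix D assume "D \<in> C // ?R"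
    then obtain i where "D = ?R `` {?w i}"
      using CS by (auto elim!: quotientE)
    then show "D \<in> {?R `` {?w 0}, ?R `` {?w 1}}"
      using class_eq[of i] by (cases "even i") simp_all
  next
    fix D assume "D \<in> {?R `` {?w 0}, ?R `` {?w 1}}"
    moreover have "?w 0 \<in> C" "?w 1 \<in> C"
      using CS \<open>2 \<le> Suc N\<close> by (auto simp del: walk.simps)
    ultimately show "D \<in> C // ?R"
      by (auto intro: quotientI simp del: walk.simps)
  qed
  moreover have "?R `` {?w 0} \<noteq> ?R `` {?w 1}"
  proof
    \<comment> \<open>Each reflection toggles \<open>P\<close> on \<open>C\<close>, and a turn
      consists of two reflections, so \<open>P\<close> is constant on orbits and separates the
      positions 0 and 1.\<close>
    define P where "P x \<longleftrightarrow> (\<exists>i\<le>N. even i \<and> x = ?w i)" for x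
    have P_walk: "P (?w i) \<longleftrightarrow> even i" if i: "i \<le> N" for i
    proof
      assume "P (?w i)"
      then obtain j where j: "j \<le> N" "even j" "?w i = ?w j"
        unfolding P_def by blast
      then have "i = j"
        using inj_onD[OF inj, of i j] i by simp
      then show "even i"
        using j by simp
    next
      assume "even i"
      then show "P (?w i)"
        unfolding P_def using i by blast
    qed
    have P_g: "P (g s' x) \<longleftrightarrow> \<not> P x" if x: "x \<in> C" for x s'
    proof -
      obtain i where i: "i \<le> N" "x = ?w i"
        using x CS by blast
      then obtain j where j: "j \<le> N" "g s' x = ?w j" "even j \<noteq> even i"
        using nb[of i s'] by blast
      show ?thesis
        using P_walk[OF i(1)] P_walk[OF j(1)] i(2) j(2,3) by simp
    qed
    have not_P: "\<not> P x" if "x \<notin> C" for x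
      using that unfolding CS P_def by blast
    have g_C: "g s' x \<in> C \<longleftrightarrow> x \<in> C" if "x \<in> V" for x s'
      using linked_g_iff[OF that] C by simp
    have P_turn: "P (turn x) = P x" if x: "x \<in> V" for x
    proof (cases "x \<in> C")
      case True
      then have "g Lower x \<in> C"
        using g_C[OF x] by blast
      then show ?thesis
        unfolding turn_def o_apply using P_g[OF True, of Lower] P_g[of "g Lower x" Upper] by blast
    next
      case False
      then have "g Lower x \<notin> C"
        using g_C[OF x] by blast
      then have "g Upper (g Lower x) \<notin> C"
        using g_C[OF g_mem[OF x]] by blast
      then show ?thesis
        unfolding turn_def o_apply using not_P False by blast
    qed
    assume "?R `` {?w 0} = ?R `` {?w 1}"
    then have "(?w 0, ?w 1) \<in> ?R"
      by (rule eq_equiv_class[OF _ equiv_orbit_rel walk_mem[OF v]])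
    then have "conn V turn (?w 0) (?w 1)"
      unfolding orbit_rel_def by blast
    then have "P (?w 0) = P (?w 1)"
      using P_turn by (rule conn_invariant)
    then show False
      using P_walk[of 0] P_walk[of 1] \<open>2 \<le> Suc N\<close> by (simp del: walk.simps)
  qed
  ultimately show ?thesis
    using cycle by simp
qed

text \<open>From a fixed point in the component the walk must come to a standstill, since closing up
  would need an edge on the missing side. Without fixed points it never stands still and hence
  closes up.\<close>

lemma component_cases:
  assumes C: "C \<in> V // linked"
  shows "is_path E C \<and> \<not> is_cycle E C \<and> card (C // orbit_rel V turn) = 1 \<or>
    is_cycle E C \<and> \<not> is_path E C \<and> card (C // orbit_rel V turn) = 2"
proof (cases "\<exists>v s. v \<in> C \<and> g (flip s) v = v")
  case True
  then obtain v s where vs: "v \<in> C" "g (flip s) v = v"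
    by blast
  then have v: "v \<in> V" "C = linked `` {v}"
    using C in_quotient_imp_subset[OF equiv_linked C] equiv_linked
    by (blast, metis Image_singleton_iff equiv_class_eq quotientE)
  obtain N where N: "inj_on (walk s v) {..N}" "walk s v (Suc N) \<in> walk s v ` {..N}"
    using first_repeat v by blast
  have "walk s v (Suc N) = walk s v N"
  proof (rule ccontr)
    assume a: "walk s v (Suc N) \<noteq> walk s v N"
    then have "odd N" "walk s v (Suc N) = v"
      using repeat_cases[OF v(1) N] by auto
    moreover from this have "alt s N = flip s"
      by (simp add: alt_def)
    ultimately have "walk s v N = v"
      using walk_back[OF v(1), of s N] vs by simp
    with a \<open>walk s v (Suc N) = v\<close> show False
      by simp
  qed
  then show ?thesis
    using quotient_path[OF v N(1) vs(2)] not_path_and_cycle by blast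
next
  case False
  obtain v where v: "v \<in> V" "C = linked `` {v}"
    using C by (auto elim: quotientE)
  obtain N where N: "inj_on (walk Upper v) {..N}" "walk Upper v (Suc N) \<in> walk Upper v ` {..N}"
    using first_repeat v by blast
  have "walk Upper v N \<in> C"
    using walk_linked v by auto
  then have "walk Upper v (Suc N) \<noteq> walk Upper v N"
    using False by (metis flip_flip walk.simps(2))
  then show ?thesis
    using repeat_cases[OF v(1) N] quotient_cycle[OF v N(1)] not_path_and_cycle by blast
qed

text \<open>Every orbit lies in a single component by \<open>orbit_rel_linked\<close>, so the orbits
  can be counted component by component.\<close>

lemma index_eq_ncyc:
  "2 * card {C \<in> V // linked. is_cycle E C} + card {C \<in> V // linked. is_path E C} = ncyc V turn"
proof -
  let ?K = "V // linked" and ?R = "orbit_rel V turn"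
  have finK: "finite ?K"
    using fin by (auto intro!: finite_quotient simp: linked_def)
  have sub: "C \<subseteq> V" if "C \<in> ?K" for C
    using that in_quotient_imp_subset[OF equiv_linked] by blast
  have "V // ?R = (\<Union>C\<in>?K. C // ?R)"
    using Union_quotient[OF equiv_linked] unfolding quotient_def by blast
  moreover have "card (\<Union>C\<in>?K. C // ?R) = (\<Sum>C\<in>?K. card (C // ?R))"
  proof (rule card_UN_disjoint)
    show "\<forall>C\<in>?K. finite (C // ?R)"
      using sub fin by (auto simp: quotient_def dest: finite_subset)
    have "D \<subseteq> C \<and> D \<noteq> {}" if C: "C \<in> ?K" and D: "D \<in> C // ?R" for C D
    proof -
      obtain x where x: "x \<in> C" "D = ?R `` {x}"
        using D by (auto elim: quotientE)
      then have "linked `` {x} = C"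
        using C equiv_linked by (metis Image_singleton_iff equiv_class_eq quotientE)
      moreover have "(x, x) \<in> ?R"
        using x sub[OF C] by (auto simp: orbit_rel_def)
      ultimately show ?thesis
        using x orbit_rel_linked by blast
    qed
    then show "\<forall>C\<in>?K. \<forall>D\<in>?K. C \<noteq> D \<longrightarrow> C // ?R \<inter> D // ?R = {}"
      using quotient_disj[OF equiv_linked] by blast
  qed (rule finK)
  moreover have "(\<Sum>C\<in>?K. card (C // ?R)) =
      (\<Sum>C\<in>?K. (if is_cycle E C then 2 else 0) + (if is_path E C then 1 else 0))"
    by (rule sum.cong) (use component_cases in auto)
  moreover have "(\<Sum>C\<in>?K. (if is_cycle E C then 2 else 0) + (if is_path E C then 1 else 0 :: nat)) =
      2 * card {C \<in> ?K. is_cycle E C} + card {C \<in> ?K. is_path E C}"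
    using finK by (simp add: sum.distrib sum.If_cases Int_def)
  ultimately show ?thesis
    by (simp add: ncyc_def)
qed

end

subsection \<open>Generating functions\<close>

lemma part_edges_Cons:
  "(u, w) \<in> part_edges (a # xs) \<longleftrightarrow> 1 \<le> u \<and> u \<le> a div 2 \<and> w = a + 1 - u \<or>
    (\<exists>u' w'. u = a + u' \<and> w = a + w' \<and> (u', w') \<in> part_edges xs)" (is "?L \<longleftrightarrow> ?R1 \<or> ?R2")
proof -
  let ?e = "\<lambda>xs j i u w. u = sum_list (take j xs) + i \<and> w = sum_list (take j xs) + xs ! j + 1 - i \<and>
    1 \<le> i \<and> i \<le> xs ! j div 2"
  have pe: "(u, w) \<in> part_edges xs \<longleftrightarrow> (\<exists>j<length xs. \<exists>i. ?e xs j i u w)" for xs u w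
    unfolding part_edges_def by blast
  have shift: "(\<exists>i. ?e (a # xs) (Suc j) i u w) \<longleftrightarrow> (\<exists>u' w'. u = a + u' \<and> w = a + w' \<and> (\<exists>i. ?e xs j i u' w'))" for j
  proof
    assume "\<exists>i. ?e (a # xs) (Suc j) i u w"
    then obtain i where i: "u = a + sum_list (take j xs) + i" "w = a + sum_list (take j xs) + xs ! j + 1 - i"
      "1 \<le> i" "i \<le> xs ! j div 2"
      by auto
    then have "w = a + (sum_list (take j xs) + xs ! j + 1 - i)"
      by linarith
    with i show "\<exists>u' w'. u = a + u' \<and> w = a + w' \<and> (\<exists>i. ?e xs j i u' w')"
      by (metis add.assoc)
  next
    assume "\<exists>u' w'. u = a + u' \<and> w = a + w' \<and> (\<exists>i. ?e xs j i u' w')"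
    then obtain i where i: "u = a + (sum_list (take j xs) + i)" "w = a + (sum_list (take j xs) + xs ! j + 1 - i)"
      "1 \<le> i" "i \<le> xs ! j div 2"
      by blast
    then have "?e (a # xs) (Suc j) i u w"
      by simp
    then show "\<exists>i. ?e (a # xs) (Suc j) i u w" ..
  qed
  have "?L \<longleftrightarrow> (\<exists>i. ?e (a # xs) 0 i u w) \<or> (\<exists>j<length xs. \<exists>i. ?e (a # xs) (Suc j) i u w)"
    unfolding pe length_Cons less_Suc_eq_0_disj by blast
  also have "(\<exists>i. ?e (a # xs) 0 i u w) \<longleftrightarrow> ?R1"
    by auto
  also have "(\<exists>j<length xs. \<exists>i. ?e (a # xs) (Suc j) i u w) \<longleftrightarrow> ?R2"
    unfolding shift pe by blast
  finally show ?thesis .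
qed

text \<open>Within a part, \<open>u \<le> a div 2\<close> means \<open>u < a + 1 - u\<close>; the
  strict inequality \<open>u < w\<close> therefore selects the left end of each edge and omits the
  midpoints.\<close>

lemma part_edges_iff:
  "(u, w) \<in> part_edges xs \<longleftrightarrow> 1 \<le> u \<and> u \<le> sum_list xs \<and> u < w \<and> w = refl_parts xs u"
proof (induction xs arbitrary: u w)
  case Nil
  then show ?case by (auto simp: part_edges_def)
next
  case (Cons a xs)
  show ?case
  proof (cases "u \<le> a")
    case True
    then show ?thesis
      unfolding part_edges_Cons Cons.IH by auto
  next
    case False
    define u' where "u' = u - a"
    have u: "u = a + u'" "1 \<le> u'"
      using False by (auto simp: u'_def)
    have "\<not> u \<le> a div 2"
      using False by linarith
    then show ?thesis
      unfolding part_edges_Cons Cons.IH using u refl_parts_add[OF u(2), of a xs]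
      by (auto simp del: refl_parts.simps)
  qed
qed

definition side_refl :: "nat list \<Rightarrow> nat list \<Rightarrow> side \<Rightarrow> nat \<Rightarrow> nat" where
  "side_refl xs ys s = (case s of Upper \<Rightarrow> refl_parts xs | Lower \<Rightarrow> refl_parts ys)"

lemma meander_index_eq:
  assumes "sum_list xs = n" "sum_list ys = n"
  shows "meander_index n xs ys = cyc_index xs ys"
proof -
  interpret two_involutions "{1..n}" "side_refl xs ys"
    using assms refl_parts_gt refl_parts_bound[of _ xs] refl_parts_bound[of _ ys] refl_parts_invol
    by unfold_locales (auto simp: side_refl_def split: side.split)
  have "e \<in> meander_edges xs ys \<longleftrightarrow> e \<in> E" for e
  proof -
    obtain s u w where e: "e = (s, u, w)"
      by (cases e)
    have "e \<in> meander_edges xs ys \<longleftrightarrow> u \<in> {1..n} \<and> u < w \<and> w = side_refl xs ys s u"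
      unfolding e meander_edges_def using assms by (cases s) (auto simp: part_edges_iff side_refl_def)
    also have "\<dots> \<longleftrightarrow> e \<in> E"
    proof
      assume "u \<in> {1..n} \<and> u < w \<and> w = side_refl xs ys s u"
      then show "e \<in> E"
        using edge_mem[of u s] by (auto simp: e edge_def)
    next
      assume "e \<in> E"
      then obtain v where v: "e = edge s v" "v \<in> {1..n}" "side_refl xs ys s v \<noteq> v"
        unfolding E_def e edge_def by blast
      show "u \<in> {1..n} \<and> u < w \<and> w = side_refl xs ys s u"
      proof (cases "v < side_refl xs ys s v")
        case True
        then show ?thesis
          using v by (auto simp: e edge_def)
      next
        case False
        \<comment> \<open>Here \<open>v\<close> is the right end of the edge; the involution
          expresses the same edge through its left end \<open>u\<close>.\<close>
        then have "u = side_refl xs ys s v" "w = v" "u < v"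
          using v by (auto simp: e edge_def)
        then show ?thesis
          using v g_mem[of v s] g_invol[of v s] by metis
      qed
    qed
    finally show ?thesis .
  qed
  then have E: "meander_edges xs ys = E"
    by blast
  have "turn = refl_parts xs \<circ> refl_parts ys"
    by (simp add: turn_def side_refl_def)
  moreover have "components {1..n} E = {1..n} // linked"
    by (simp only: components_def linked_def)
  ultimately show ?thesis
    unfolding meander_index_def cyc_index_def using index_eq_ncyc E assms by (simp add: Let_def)
qed

section \<open>Pairs of compositions with a given overhang\<close>

definition pairs :: "nat \<Rightarrow> (nat list \<times> nat list) set" where
  "pairs d = {(xs, ys). set xs \<subseteq> {3, 4} \<and> set ys \<subseteq> {3, 4} \<and> sum_list xs = sum_list ys + d}"

text \<open>\<open>[1, 1]\<close> and \<open>[2, 1]\<close> are the lists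
  \<open>[b - 2 * a, a]\<close> that \<open>cyc_index_reduce_small\<close> makes of a part
  \<open>b = 3\<close> or \<open>b = 4\<close> set against \<open>a = 1\<close>. The last branch is
  meant for overhang 3.\<close>

definition prefix :: "nat \<Rightarrow> nat list" where
  "prefix d = (if d = 0 then [] else if d = 1 then [1] else if d = 2 then [1, 1] else [2, 1])"

definition weight :: "nat list \<times> nat list \<Rightarrow> nat" where
  "weight = (\<lambda>(xs, ys). sum_list xs)"

text \<open>An element of \<open>pairs d\<close> lists the parts not yet removed; the prefix fills
  the shorter remaining side up to equal length, so \<open>weight\<close> is the number of vertices
  of the reduced meander.\<close>

definition ind :: "nat \<Rightarrow> nat list \<times> nat list \<Rightarrow> nat" where
  "ind d = (\<lambda>(xs, ys). cyc_index xs (prefix d @ ys))"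

section \<open>Generating functions for two statistics\<close>

definition gen_fun :: "'a set \<Rightarrow> ('a \<Rightarrow> nat) \<Rightarrow> ('a \<Rightarrow> nat) \<Rightarrow> bifps" where
  "gen_fun S w v = Abs_fps (\<lambda>n. Abs_fps (\<lambda>k. of_nat (card {s \<in> S. w s = n \<and> v s = k})))"

lemma gen_fun_nth: "gen_fun S w v $ n $ k = of_nat (card {s \<in> S. w s = n \<and> v s = k})"
  by (simp add: gen_fun_def)

lemma gen_fun_Un:
  assumes "S \<inter> T = {}" "\<And>n. finite {s \<in> S \<union> T. w s = n}"
  shows "gen_fun (S \<union> T) w v = gen_fun S w v + gen_fun T w v"
proof (rule fps_ext, rule fps_ext)
  fix n k
  have "{s \<in> S \<union> T. w s = n \<and> v s = k} = {s \<in> S. w s = n \<and> v s = k} \<union> {s \<in> T. w s = n \<and> v s = k}"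
    by blast
  moreover have "finite {s \<in> S. w s = n \<and> v s = k}" "finite {s \<in> T. w s = n \<and> v s = k}"
    by (rule finite_subset[OF _ assms(2)[of n]]; blast)+
  ultimately show "gen_fun (S \<union> T) w v $ n $ k = (gen_fun S w v + gen_fun T w v) $ n $ k"
    using assms(1) by (simp add: gen_fun_nth card_Un_disjoint disjoint_iff)
qed

lemma gen_fun_image:
  assumes inj: "inj_on h S" and h: "\<And>s. s \<in> S \<Longrightarrow> w' (h s) = w s + a \<and> v' (h s) = v s + b"
  shows "gen_fun (h ` S) w' v' = X ^ a * Y ^ b * gen_fun S w v"
proof (rule fps_ext, rule fps_ext)
  fix n k
  have "{s \<in> h ` S. w' s = n \<and> v' s = k} = h ` {s \<in> S. w s + a = n \<and> v s + b = k}"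
    using h by auto
  moreover have "inj_on h {s \<in> S. w s + a = n \<and> v s + b = k}"
    using inj by (rule inj_on_subset) auto
  ultimately have "gen_fun (h ` S) w' v' $ n $ k = of_nat (card {s \<in> S. w s + a = n \<and> v s + b = k})"
    by (simp add: gen_fun_nth card_image)
  also have "\<dots> = (if n < a \<or> k < b then 0 else gen_fun S w v $ (n - a) $ (k - b))"
  proof (cases "n < a \<or> k < b")
    case True
    then have "{s \<in> S. w s + a = n \<and> v s + b = k} = {}"
      by auto
    with True show ?thesis
      by (simp only: card.empty of_nat_0 if_True)
  next
    case False
    then have "w s + a = n \<and> v s + b = k \<longleftrightarrow> w s = n - a \<and> v s = k - b" for s
      by auto
    then show ?thesis
      using False by (simp add: gen_fun_nth)
  qed
  also have "\<dots> = (X ^ a * Y ^ b * gen_fun S w v) $ n $ k"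
    by (simp add: mult.assoc fps_X_power_mult_nth fps_const_power)
  finally show "gen_fun (h ` S) w' v' $ n $ k = (X ^ a * Y ^ b * gen_fun S w v) $ n $ k" .
qed

lemma gen_fun_single: "w s = 0 \<Longrightarrow> v s = 0 \<Longrightarrow> gen_fun {s} w v = 1"
proof (rule fps_ext, rule fps_ext)
  fix n k
  assume "w s = 0" "v s = 0"
  then have "{t \<in> {s}. w t = n \<and> v t = k} = (if n = 0 \<and> k = 0 then {s} else {})"
    by auto
  then show "gen_fun {s} w v $ n $ k = 1 $ n $ k"
    by (auto simp: gen_fun_nth)
qed

lemma finite_lists_sum: "0 \<notin> J \<Longrightarrow> finite J \<Longrightarrow> finite {xs. set xs \<subseteq> J \<and> sum_list xs \<le> (n :: nat)}"
proof -
  assume J: "0 \<notin> J" "finite J"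
  have "length xs \<le> sum_list xs" if "set xs \<subseteq> J" for xs
    using that
  proof (induction xs)
    case (Cons a xs)
    then have "a \<in> J"
      by simp
    then have "a \<noteq> 0"
      using J(1) by metis
    with Cons show ?case
      by simp
  qed simp
  then have "{xs. set xs \<subseteq> J \<and> sum_list xs \<le> n} \<subseteq> {xs. set xs \<subseteq> J \<and> length xs \<le> n}"
    by fastforce
  then show ?thesis
    using finite_lists_length_le[OF J(2)] finite_subset by blast
qed

lemma finite_pairs: "finite {s \<in> pairs d. weight s = n}"
proof (rule finite_subset)
  let ?L = "{xs. set xs \<subseteq> {3, 4} \<and> sum_list xs \<le> (n :: nat)}"
  show "{s \<in> pairs d. weight s = n} \<subseteq> ?L \<times> ?L"
    by (auto simp: pairs_def weight_def)
  show "finite (?L \<times> ?L)"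
    using finite_lists_sum[of "{3, 4}" n] by simp
qed

section \<open>Removal of leading parts\<close>

definition push :: "nat \<Rightarrow> nat list \<times> nat list \<Rightarrow> nat list \<times> nat list" where
  "push a = (\<lambda>(xs, ys). (a # ys, xs))"

lemma inj_push: "inj_on (push a) S"
  by (auto simp: push_def inj_on_def)

text \<open>For \<open>d \<ge> 1\<close> the longer remaining side has a leading part
  \<open>a\<close>, and it covers the whole overhang as \<open>d \<le> 3\<close>. Its removal makes
  the side of \<open>a\<close> the one that sticks out, by \<open>a - d\<close>, hence the exchange
  of sides in \<open>push\<close>.\<close>

lemma pairs_step:
  assumes "1 \<le> d" "d \<le> 3"
  shows "pairs d = push 3 ` pairs (3 - d) \<union> push 4 ` pairs (4 - d)"
proof (intro equalityI subsetI)
  fix s assume "s \<in> pairs d"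
  then obtain xs ys where s: "s = (xs, ys)" "set xs \<subseteq> {3, 4}" "set ys \<subseteq> {3, 4}" "sum_list xs = sum_list ys + d"
    by (auto simp: pairs_def)
  then obtain a zs where xs: "xs = a # zs"
    using assms by (cases xs) auto
  have "s = push a (ys, zs)"
    by (simp add: s xs push_def)
  moreover have "a = 3 \<and> (ys, zs) \<in> pairs (3 - d) \<or> a = 4 \<and> (ys, zs) \<in> pairs (4 - d)"
    using s xs assms by (auto simp: pairs_def)
  ultimately show "s \<in> push 3 ` pairs (3 - d) \<union> push 4 ` pairs (4 - d)"
    by blast
qed (use assms in \<open>auto simp: pairs_def push_def\<close>)

text \<open>This is the subtractive Euclidean algorithm: the leading parts run through 3 and 4, 2
  and 3, 1 and 2, and a single 1 is left.\<close>

lemma cyc_index_3_4: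
  assumes "sum_list xs = sum_list ys + 1"
  shows "cyc_index (3 # xs) (4 # ys) = cyc_index xs (1 # ys)"
proof -
  have "cyc_index (3 # xs) (4 # ys) = cyc_index (2 # xs) (3 # ys)"
    using cyc_index_reduce_big[of 3 4 xs ys] assms by simp
  also have "\<dots> = cyc_index (1 # xs) (2 # ys)"
    using cyc_index_reduce_big[of 2 3 xs ys] assms by simp
  also have "\<dots> = cyc_index xs (1 # ys)"
    using cyc_index_reduce_small[of 1 2 xs ys] assms by simp
  finally show ?thesis .
qed

text \<open>The prefix and \<open>a\<close> are reduced against each other. For \<open>a = 3\<close>
  with \<open>d = 2\<close> or \<open>d = 3\<close> the reductions arrive at two equal leading parts
  1, whose removal costs one fixed point; in the other cases reduction alone ends at the prefix for
  overhang \<open>a - d\<close>.\<close>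

lemma ind_push:
  assumes s: "s \<in> pairs (a - d)" and d: "1 \<le> d" "d \<le> 3" and a: "a \<in> {3, 4}"
  shows "ind d (push a s) = ind (a - d) s + (if a = 3 \<and> d \<noteq> 1 then 1 else 0)"
proof -
  obtain xs ys where xy: "s = (xs, ys)" "sum_list xs = sum_list ys + (a - d)"
    using s by (auto simp: pairs_def)
  \<comment> \<open>The reductions expect the smaller leading part in the first argument, and the
    prefix begins with 1 or 2.\<close>
  have sym: "cyc_index (a # ys) (prefix d @ xs) = cyc_index (prefix d @ xs) (a # ys)"
    using xy d a by (intro cyc_index_sym) (auto simp: prefix_def)
  consider "a = 3" "d = 1" | "a = 3" "d = 2" | "a = 3" "d = 3" | "a = 4" "d = 1" | "a = 4" "d = 2" | "a = 4" "d = 3"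
    using a d by force
  then show ?thesis
  proof cases
    case 1
    then show ?thesis
      using xy sym cyc_index_reduce_small[of 1 3 xs ys] by (simp add: ind_def push_def prefix_def)
  next
    case 2
    then show ?thesis
      using xy sym cyc_index_reduce_small[of 1 3 "1 # xs" ys] cyc_index_Cons_same[of xs "1 # ys" 1]
      by (simp add: ind_def push_def prefix_def)
  next
    case 3
    then show ?thesis
      using xy sym cyc_index_reduce_big[of 2 3 "1 # xs" ys] cyc_index_reduce_small[of 1 2 "1 # xs" ys]
        cyc_index_Cons_same[of xs ys 1]
      by (simp add: ind_def push_def prefix_def)
  next
    case 4
    then show ?thesis
      using xy sym cyc_index_reduce_small[of 1 4 xs ys] by (simp add: ind_def push_def prefix_def)
  next
    case 5
    then show ?thesis
      using xy sym cyc_index_reduce_small[of 1 4 "1 # xs" ys] cyc_index_reduce_small[of 1 2 xs "1 # ys"]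
      by (simp add: ind_def push_def prefix_def)
  next
    case 6
    then show ?thesis
      using xy sym cyc_index_reduce_small[of 2 4 "1 # xs" ys] cyc_index_reduce_small[of 1 2 xs ys]
      by (simp add: ind_def push_def prefix_def)
  qed
qed

abbreviation F :: "nat \<Rightarrow> bifps" where
  "F d \<equiv> gen_fun (pairs d) weight (ind d)"

text \<open>Either part shortens the reduced meander by the \<open>d\<close> vertices of the old
  overhang; the factor \<open>Y\<close> records the fixed point split off in
  \<open>ind_push\<close>.\<close>

lemma F_step:
  assumes d: "1 \<le> d" "d \<le> 3"
  shows "F d = X ^ d * Y ^ (if d = 1 then 0 else 1) * F (3 - d) + X ^ d * F (4 - d)"
proof -
  have w: "weight (push a s) = weight s + d" if "s \<in> pairs (a - d)" "a \<in> {3, 4}" for a s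
    using that d by (auto simp: pairs_def push_def weight_def)
  have "push 3 ` pairs (3 - d) \<inter> push 4 ` pairs (4 - d) = {}"
    by (auto simp: push_def)
  then have "gen_fun (push 3 ` pairs (3 - d) \<union> push 4 ` pairs (4 - d)) weight (ind d) =
      gen_fun (push 3 ` pairs (3 - d)) weight (ind d) + gen_fun (push 4 ` pairs (4 - d)) weight (ind d)"
    by (rule gen_fun_Un) (unfold pairs_step[OF d, symmetric], rule finite_pairs)
  then have "F d = gen_fun (push 3 ` pairs (3 - d)) weight (ind d) + gen_fun (push 4 ` pairs (4 - d)) weight (ind d)"
    unfolding pairs_step[OF d, symmetric] .
  also have "gen_fun (push 3 ` pairs (3 - d)) weight (ind d) = X ^ d * Y ^ (if d = 1 then 0 else 1) * F (3 - d)"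
  proof (rule gen_fun_image[OF inj_push])
    fix s assume "s \<in> pairs (3 - d)"
    then show "weight (push 3 s) = weight s + d \<and> ind d (push 3 s) = ind (3 - d) s + (if d = 1 then 0 else 1)"
      using w[of s 3] ind_push[of s 3 d] d by simp
  qed
  also have "gen_fun (push 4 ` pairs (4 - d)) weight (ind d) = X ^ d * Y ^ 0 * F (4 - d)"
  proof (rule gen_fun_image[OF inj_push])
    fix s assume "s \<in> pairs (4 - d)"
    then show "weight (push 4 s) = weight s + d \<and> ind d (push 4 s) = ind (4 - d) s + 0"
      using w[of s 4] ind_push[of s 4 d] d by simp
  qed
  finally show ?thesis
    by simp
qed

text \<open>Without overhang a leading part is removed on both sides. The last two sets are mirror
  images, written over the same \<open>pairs 1\<close> so that both can be evaluated by
  \<open>F 1\<close>.\<close>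

lemma pairs_0:
  "pairs 0 = {([], [])} \<union> ((\<lambda>(xs, ys). (3 # xs, 3 # ys)) ` pairs 0 \<union> ((\<lambda>(xs, ys). (4 # xs, 4 # ys)) ` pairs 0 \<union>
     ((\<lambda>(xs, ys). (3 # xs, 4 # ys)) ` pairs 1 \<union> (\<lambda>(xs, ys). (4 # ys, 3 # xs)) ` pairs 1)))" (is "_ = ?R")
proof (intro equalityI subsetI)
  fix s assume s: "s \<in> pairs 0"
  obtain xs ys where xy: "s = (xs, ys)"
    by (cases s)
  show "s \<in> ?R"
  proof (cases xs; cases ys)
    fix a xs' b ys' assume "xs = a # xs'" "ys = b # ys'"
    moreover from this have "a = 3 \<or> a = 4" "b = 3 \<or> b = 4" "a = 3 \<Longrightarrow> b = 3 \<Longrightarrow> (xs', ys') \<in> pairs 0"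
      "a = 4 \<Longrightarrow> b = 4 \<Longrightarrow> (xs', ys') \<in> pairs 0" "a = 3 \<Longrightarrow> b = 4 \<Longrightarrow> (xs', ys') \<in> pairs 1"
      "a = 4 \<Longrightarrow> b = 3 \<Longrightarrow> (ys', xs') \<in> pairs 1"
      using s xy by (auto simp: pairs_def)
    ultimately show ?thesis
      unfolding xy by force
  qed (use s xy in \<open>auto simp: pairs_def\<close>)
qed (auto simp: pairs_def)

text \<open>Equal leading parts \<open>a\<close> contribute \<open>a\<close> fixed points; unequal
  ones leave the prefix \<open>[1]\<close> in either order, which doubles the term in
  \<open>F 1\<close>. Its factor is \<open>X ^ 3\<close> because \<open>weight\<close> measures the
  longer remaining side, from which the part 3 was taken.\<close>

lemma F_0: "F 0 = 1 + (X ^ 3 * Y ^ 3 * F 0 + (X ^ 4 * Y ^ 4 * F 0 + (X ^ 3 * F 1 + X ^ 3 * F 1)))"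
proof -
  let ?g = "\<lambda>S. gen_fun S weight (ind 0)"
  let ?A = "(\<lambda>(xs, ys). (3 # xs, 3 # ys)) ` pairs 0" and ?B = "(\<lambda>(xs, ys). (4 # xs, 4 # ys)) ` pairs 0"
  let ?C = "(\<lambda>(xs, ys). (3 # xs, 4 # ys)) ` pairs 1" and ?D = "(\<lambda>(xs, ys). (4 # ys, 3 # xs)) ` pairs 1"
  have fin: "finite {s \<in> T. weight s = n}" if "T \<subseteq> pairs 0" for T n
    by (rule finite_subset[OF _ finite_pairs[of 0 n]]) (use that in blast)
  have sub: "{([], [])} \<union> (?A \<union> (?B \<union> (?C \<union> ?D))) \<subseteq> pairs 0"
    using pairs_0 by (rule equalityD2)
  have "?g (?C \<union> ?D) = ?g ?C + ?g ?D"
    by (rule gen_fun_Un, force, rule fin) (use sub in blast)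
  moreover have "?g (?B \<union> (?C \<union> ?D)) = ?g ?B + ?g (?C \<union> ?D)"
    by (rule gen_fun_Un, force, rule fin) (use sub in blast)
  moreover have "?g (?A \<union> (?B \<union> (?C \<union> ?D))) = ?g ?A + ?g (?B \<union> (?C \<union> ?D))"
    by (rule gen_fun_Un, force, rule fin) (use sub in blast)
  moreover have "?g ({([], [])} \<union> (?A \<union> (?B \<union> (?C \<union> ?D)))) = ?g {([], [])} + ?g (?A \<union> (?B \<union> (?C \<union> ?D)))"
    by (rule gen_fun_Un, force, rule fin) (use sub in blast)
  moreover have "?g {([], [])} = 1"
    by (rule gen_fun_single) (simp_all add: weight_def ind_def prefix_def cyc_index_def ncyc_def quotient_def)
  moreover have "?g ?A = X ^ 3 * Y ^ 3 * F 0"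
    by (rule gen_fun_image)
      (auto simp: inj_on_def pairs_def weight_def ind_def prefix_def cyc_index_Cons_same)
  moreover have "?g ?B = X ^ 4 * Y ^ 4 * F 0"
    by (rule gen_fun_image)
      (auto simp: inj_on_def pairs_def weight_def ind_def prefix_def cyc_index_Cons_same)
  moreover have "?g ?C = X ^ 3 * Y ^ 0 * F 1"
    by (rule gen_fun_image)
      (auto simp: inj_on_def pairs_def weight_def ind_def prefix_def cyc_index_3_4)
  moreover have "?g ?D = X ^ 3 * Y ^ 0 * F 1"
    by (rule gen_fun_image)
      (auto simp: inj_on_def pairs_def weight_def ind_def prefix_def cyc_index_3_4 cyc_index_sym[of "4 # _" "3 # _"])
  ultimately show ?thesis
    using pairs_0 by simp
qed

section \<open>Solution of the linear system\<close>

lemma power_eq_product: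
  fixes x :: "'a :: comm_ring_1"
  shows "x^2 = x * x" "x^3 = x * x * x" "x^4 = x * x * x * x" "x^6 = x * x * x * x * x * x"
    "x^7 = x * x * x * x * x * x * x" "x^9 = x * x * x * x * x * x * x * x * x"
  by (simp_all add: eval_nat_numeral mult.assoc)

text \<open>Eliminating \<open>f2\<close> and \<open>f3\<close> from the equation for
  \<open>f1\<close> gives the factor \<open>1 - x^2 - x^3 * y - x^4 + x^6\<close> of
  \<open>f1\<close>, and the factor \<open>x^4 * y * (1 - x^2)\<close> of \<open>f0\<close>. The
  latter times the coefficient \<open>2 * x^3\<close> of \<open>f1\<close> in the equation for
  \<open>f0\<close> yields the last two terms of the denominator.\<close>

lemma linear_system:
  fixes x y f0 f1 f2 f3 :: "'a :: comm_ring_1"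
  assumes 0: "f0 = 1 + (x ^ 3 * y ^ 3 * f0 + (x ^ 4 * y ^ 4 * f0 + (x ^ 3 * f1 + x ^ 3 * f1)))"
    and 1: "f1 = x * f2 + x * f3" and 2: "f2 = x ^ 2 * y * f1 + x ^ 2 * f2"
    and 3: "f3 = x ^ 3 * y * f0 + x ^ 3 * f1"
  shows "f0 * ((1 - x^3 * y^3 - x^4 * y^4) * (1 - x^2 - x^3 * y - x^4 + x^6) - 2 * x^7 * y + 2 * x^9 * y) =
    1 - x^2 - x^3 * y - x^4 + x^6"
proof -
  let ?D = "1 - x^2 - x^3 * y - x^4 + x^6"
  \<comment> \<open>The multipliers \<open>1 - x^2\<close>, \<open>x\<close> and
    \<open>x * (1 - x^2)\<close> of the three equations come from the elimination, cleared of the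
    denominator \<open>1 - x^2\<close> of \<open>f2\<close>.\<close>
  have "?D * f1 - x^4 * y * (1 - x^2) * f0 = (1 - x^2) * (f1 - (x * f2 + x * f3)) +
      x * (f2 - (x ^ 2 * y * f1 + x ^ 2 * f2)) + x * (1 - x^2) * (f3 - (x ^ 3 * y * f0 + x ^ 3 * f1))"
    unfolding power_eq_product by (simp add: algebra_simps)
  also have "\<dots> = 0"
    unfolding 1[symmetric] 2[symmetric] 3[symmetric] by simp
  finally have f1: "?D * f1 = x^4 * y * (1 - x^2) * f0"
    by simp
  \<comment> \<open>The identity is stated for arbitrary \<open>d\<close>, so that the polynomial
    \<open>?D\<close> is not expanded.\<close>
  have "f0 * ((1 - x^3 * y^3 - x^4 * y^4) * d - 2 * x^7 * y + 2 * x^9 * y) - d =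
      d * (f0 - (1 + (x ^ 3 * y ^ 3 * f0 + (x ^ 4 * y ^ 4 * f0 + (x ^ 3 * f1 + x ^ 3 * f1))))) +
      2 * x ^ 3 * (d * f1 - x^4 * y * (1 - x^2) * f0)" for d
    unfolding power_eq_product by (simp add: algebra_simps)
  then have "f0 * ((1 - x^3 * y^3 - x^4 * y^4) * ?D - 2 * x^7 * y + 2 * x^9 * y) - ?D =
      ?D * (f0 - f0) + 2 * x ^ 3 * (?D * f1 - ?D * f1)"
    unfolding 0[symmetric] f1[symmetric] .
  then show ?thesis
    by simp
qed

lemma F_closed_form:
  "F 0 = (1 - X^2 - X^3 * Y - X^4 + X^6) /
      ((1 - X^3 * Y^3 - X^4 * Y^4) * (1 - X^2 - X^3 * Y - X^4 + X^6) - 2 * X^7 * Y + 2 * X^9 * Y)"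
    (is "_ = ?N / ?D")
proof -
  have "F 1 = X * F 2 + X * F 3" "F 2 = X ^ 2 * Y * F 1 + X ^ 2 * F 2"
    "F 3 = X ^ 3 * Y * F 0 + X ^ 3 * F 1"
    by (use F_step[of 1] in simp, use F_step[of 2] in simp, use F_step[of 3] in simp)
  then have "F 0 * ?D = ?N"
    by (rule linear_system[OF F_0])
  moreover have D: "?D $ 0 = 1"
    by (simp add: fps_mult_nth_0 fps_X_power_nth)
  then have "?N / ?D * ?D = ?N"
    by (rule bifps_divide_mult)
  ultimately have "F 0 * ?D = ?N / ?D * ?D"
    by (simp only:)
  moreover have "?D \<noteq> 0"
    using D by (metis fps_zero_nth zero_neq_one)
  ultimately show ?thesis
    using mult_right_cancel by blast
qed

lemma meander_count_eq:
  assumes "0 \<notin> J"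
  shows "meander_count J n k = card {(xs, ys). set xs \<subseteq> J \<and> set ys \<subseteq> J \<and>
    sum_list xs = n \<and> sum_list ys = n \<and> cyc_index xs ys = k}"
proof -
  have "composition m xs \<longleftrightarrow> sum_list xs = m" if "set xs \<subseteq> J" for m xs
    using that assms by (auto simp: composition_def intro!: gr0I)
  then show ?thesis
    unfolding meander_count_def
    by (intro arg_cong[of _ _ card]) (auto simp: meander_index_eq)
qed

lemma meander_gf_eq: "meander_gf {3, 4} = F 0"
proof (rule fps_ext, rule fps_ext)
  fix n k
  have "{(xs, ys). set xs \<subseteq> {3, 4} \<and> set ys \<subseteq> {3, 4} \<and> sum_list xs = n \<and> sum_list ys = n \<and> cyc_index xs ys = k} =
      {s \<in> pairs 0. weight s = n \<and> ind 0 s = k}"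
    by (auto simp: pairs_def weight_def ind_def prefix_def)
  then show "meander_gf {3, 4} $ n $ k = F 0 $ n $ k"
    by (simp add: meander_gf_def gen_fun_nth meander_count_eq)
qed

section \<open>Scaling of the parts and substitution of powers\<close>

lemma compose_X_power_nth:
  fixes H :: "'a :: comm_ring_1 fps"
  assumes "c \<ge> 1"
  shows "(H oo fps_X ^ c) $ n = (if c dvd n then H $ (n div c) else 0)"
proof -
  have "(H oo fps_X ^ c) $ n = (\<Sum>i=0..n. H $ i * (if n = c * i then 1 else 0))"
    by (simp add: fps_compose_nth power_mult[symmetric] fps_X_power_nth)
  also have "\<dots> = (if c dvd n then H $ (n div c) else 0)"
  proof (cases "c dvd n")
    case True
    then have "n = c * i \<longleftrightarrow> n div c = i" for i
      using assms by auto
    then show ?thesis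
      using True by (simp add: if_distrib div_le_dividend cong: if_cong)
  next
    case False
    then have "n \<noteq> c * i" for i
      by auto
    then show ?thesis
      using False by simp
  qed
  finally show ?thesis .
qed

text \<open>Multiplying all parts by \<open>c\<close> is a bijection that multiplies size and index
  by \<open>c\<close>. The counts therefore sit at multiples of \<open>c\<close> in both variables
  and vanish elsewhere, exactly as coefficients do after the substitution of powers.\<close>

lemma meander_count_scale:
  assumes c: "c \<ge> 1" and J: "0 \<notin> J"
  shows "meander_count ((*) c ` J) n k = (if c dvd n \<and> c dvd k then meander_count J (n div c) (k div c) else 0)"
proof -
  let ?S = "\<lambda>J n k. {(xs, ys). set xs \<subseteq> J \<and> set ys \<subseteq> J \<and> sum_list xs = n \<and> sum_list ys = n \<and> cyc_index xs ys = k}"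
  let ?h = "\<lambda>(xs, ys). (map ((*) c) xs, map ((*) c) ys)"
  have J': "0 \<notin> (*) c ` J"
    using J c by auto
  have inj: "inj ((*) c)"
    using c by (auto simp: inj_on_def)
  have sum: "sum_list (map ((*) c) xs) = c * sum_list xs" for xs
    by (simp add: sum_list_const_mult)
  have eq: "?S ((*) c ` J) n k = ?h ` {(xs, ys). set xs \<subseteq> J \<and> set ys \<subseteq> J \<and> c * sum_list xs = n \<and>
      c * sum_list ys = n \<and> c * cyc_index xs ys = k}"
  proof (intro equalityI subsetI)
    fix s assume "s \<in> ?S ((*) c ` J) n k"
    then obtain xs ys where s: "s = (xs, ys)" "set xs \<subseteq> (*) c ` J" "set ys \<subseteq> (*) c ` J" "sum_list xs = n"
      "sum_list ys = n" "cyc_index xs ys = k"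
      by blast
    have "xs \<in> map ((*) c) ` lists J" "ys \<in> map ((*) c) ` lists J"
      unfolding lists_image[symmetric] using s(2,3) by auto
    then obtain xs' ys' where xy: "xs = map ((*) c) xs'" "xs' \<in> lists J" "ys = map ((*) c) ys'" "ys' \<in> lists J"
      by blast
    have "c * sum_list xs' = n" "c * sum_list ys' = n"
      using s(4,5) xy sum by simp_all
    moreover from this have "sum_list xs' = sum_list ys'"
      using c by auto
    then have "c * cyc_index xs' ys' = k"
      using s(6) xy cyc_index_scale[of xs' ys' c] by simp
    moreover have "set xs' \<subseteq> J" "set ys' \<subseteq> J"
      using xy by auto
    moreover have "s = ?h (xs', ys')"
      using s(1) xy by simp
    ultimately show "s \<in> ?h ` {(xs, ys). set xs \<subseteq> J \<and> set ys \<subseteq> J \<and> c * sum_list xs = n \<and>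
      c * sum_list ys = n \<and> c * cyc_index xs ys = k}"
      by (intro image_eqI[of _ _ "(xs', ys')"]) simp_all
  next
    fix s assume "s \<in> ?h ` {(xs, ys). set xs \<subseteq> J \<and> set ys \<subseteq> J \<and> c * sum_list xs = n \<and>
      c * sum_list ys = n \<and> c * cyc_index xs ys = k}"
    then obtain xs ys where s: "s = ?h (xs, ys)" "set xs \<subseteq> J" "set ys \<subseteq> J" "c * sum_list xs = n"
      "c * sum_list ys = n" "c * cyc_index xs ys = k"
      by blast
    moreover from this have "sum_list xs = sum_list ys"
      using c by auto
    ultimately show "s \<in> ?S ((*) c ` J) n k"
      using sum cyc_index_scale[of xs ys c] by auto
  qed
  have "inj ?h"
    by (rule injI, clarsimp simp only: prod.case prod.inject inj_eq[OF inj_mapI[OF inj]]) simp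
  then have "card (?S ((*) c ` J) n k) = card {(xs, ys). set xs \<subseteq> J \<and> set ys \<subseteq> J \<and> c * sum_list xs = n \<and>
      c * sum_list ys = n \<and> c * cyc_index xs ys = k}"
    unfolding eq by (rule card_image[OF inj_on_subset[OF _ subset_UNIV]])
  also have "\<dots> = (if c dvd n \<and> c dvd k then card (?S J (n div c) (k div c)) else 0)"
  proof (cases "c dvd n \<and> c dvd k")
    case True
    then have "c * m = n \<longleftrightarrow> m = n div c" "c * m = k \<longleftrightarrow> m = k div c" for m
      using c by auto
    then show ?thesis
      using True by simp
  next
    case False
    then have "{(xs, ys). set xs \<subseteq> J \<and> set ys \<subseteq> J \<and> c * sum_list xs = n \<and>
      c * sum_list ys = n \<and> c * cyc_index xs ys = k} = {}"
      by auto
    then show ?thesis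
      using False by (simp only: card.empty if_False)
  qed
  finally show ?thesis
    unfolding meander_count_eq[OF J] meander_count_eq[OF J'] .
qed

lemma meander_gf_scale:
  assumes "c \<ge> 1" "0 \<notin> J"
  shows "meander_gf ((*) c ` J) = subst_powers c (meander_gf J)"
proof (rule fps_ext, rule fps_ext)
  fix n k
  show "meander_gf ((*) c ` J) $ n $ k = subst_powers c (meander_gf J) $ n $ k"
    using assms by (simp add: meander_gf_def subst_powers_def compose_X_power_nth meander_count_scale)
qed

theorem theorem4p2:
  shows "meander_gf {3, 4} =
      (1 - X^2 - X^3 * Y - X^4 + X^6) /
      ((1 - X^3 * Y^3 - X^4 * Y^4) * (1 - X^2 - X^3 * Y - X^4 + X^6)
        - 2 * X^7 * Y + 2 * X^9 * Y)
    \<and> (\<forall>c\<ge>1. meander_gf {3 * c, 4 * c} = subst_powers c (meander_gf {3, 4}))"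
proof (intro conjI allI impI)
  fix c :: nat assume "c \<ge> 1"
  moreover have "{3 * c, 4 * c} = (*) c ` {3, 4}"
    by (simp add: mult.commute)
  ultimately show "meander_gf {3 * c, 4 * c} = subst_powers c (meander_gf {3, 4})"
    using meander_gf_scale[of c "{3, 4}"] by simp
qed (use meander_gf_eq F_closed_form in simp)

end
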